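(* Let $b\ge 70$ and let $\{X_n\}_{n\ge 0}$ be the linearly reinforced random walk with $c=2$ on the tree ${\bf T}$. Let $T=T(b)$ be its speed. Then for every $\epsilon>0$ there exists a positive number $\alpha=\alpha(b,\epsilon)$ such that $$\lim_{n\to\infty}\frac{-1}{n}\log {\bf P}\big(h(X_n)\ge (T+\epsilon)n\big)=\alpha .$$
   Context: ${\bf T}$ is the infinite tree in which every vertex has $b+1$ neighbors, except one vertex, the root ${\bf 0}$, which has $b$ neighbors. $h(x)$ denotes the number of edges on the path from the root to the vertex $x$. Linearly reinforced random walk with parameter $c>1$: $X_0={\bf 0}$; every edge $e$ has initial weight $w(e,0)=1$. Given the history up to time $i$, $X_{i+1}$ is a neighbor of $X_i$ chosen with probability proportional to the current weights $w(e,i)$ of the edges $e$ incident to $X_i$. The weight of an edge that has been traversed $k$ times (in either direction) up to a given time is $1+k(c-1)$ at that time; so for $c=2$ the weight is $1+k$. Speed: for $c=2$ and any $b\ge 2$ it is known that there is a constant $T=T(b)$ with $0<T<b/(b+2)$ such that $\lim_{n\to\infty} h(X_n)/n=T$ almost surely.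
   Formalization: When T+ε > 1 the event h(X_n) ≥ (T+ε)n is impossible for n ≥ 1, so the limit is +∞ and no finite α exists; here α may be +∞ in that case, and is a finite positive number whenever T+ε ≤ 1. *)

theory Defs
  imports "HOL-Probability.Probability"
begin

(* A vertex is the list of child indices met on the path from it up to the root:
   the root is [], the children of x are i # x for i < b, and the parent of i # x is x.
   Hence the path from the root to x has length x edges. *)

type_synonym vertex = "nat list"

definition tree_vertices :: "nat \<Rightarrow> vertex set" where
  "tree_vertices b = lists {..<b}"

definition tree_adj :: "nat \<Rightarrow> vertex \<Rightarrow> vertex \<Rightarrow> bool" where
  "tree_adj b x y \<longleftrightarrow> x \<in> tree_vertices b \<and> y \<in> tree_vertices b \<and>
     (\<exists>i. y = i # x \<or> x = i # y)"

definition height :: "vertex \<Rightarrow> nat" where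
  "height x = length x"

lemma card_neighbours:
  assumes "x \<in> tree_vertices b"
  shows "card {y. tree_adj b x y} = (if x = [] then b else b + 1)"
proof -
  have fin: "card ((\<lambda>i. i # x) ` {..<b}) = b" "finite ((\<lambda>i. i # x) ` {..<b})"
    by (auto simp: card_image inj_on_def)
  show ?thesis
  proof (cases x)
    case Nil
    then have "{y. tree_adj b x y} = (\<lambda>i. i # x) ` {..<b}"
      by (auto simp: tree_adj_def tree_vertices_def)
    with fin Nil show ?thesis by simp
  next
    case (Cons j z)
    then have "{y. tree_adj b x y} = insert z ((\<lambda>i. i # x) ` {..<b})"
      using assms by (auto simp: tree_adj_def tree_vertices_def)
    moreover have "z \<notin> (\<lambda>i. i # x) ` {..<b}"
      using Cons by auto
    ultimately show ?thesis using fin Cons by simp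
  qed
qed

(* Edges are unordered pairs, so crossings in both directions are counted. *)
definition edge_weight :: "real \<Rightarrow> (nat \<Rightarrow> vertex) \<Rightarrow> vertex set \<Rightarrow> nat \<Rightarrow> real" where
  "edge_weight c x e n = 1 + real (card {i. i < n \<and> {x i, x (Suc i)} = e}) * (c - 1)"

definition step_prob :: "nat \<Rightarrow> real \<Rightarrow> (nat \<Rightarrow> vertex) \<Rightarrow> nat \<Rightarrow> vertex \<Rightarrow> real" where
  "step_prob b c x n y =
     (if tree_adj b (x n) y
      then edge_weight c x {x n, y} n / (\<Sum>z | tree_adj b (x n) z. edge_weight c x {x n, z} n)
      else 0)"

(* There are only countably many histories, so the conditional law of X (Suc n) is given
   by elementary conditioning on each history x 0, ..., x n of positive probability. *)
definition reinforced_walk ::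
    "nat \<Rightarrow> real \<Rightarrow> 'a measure \<Rightarrow> (nat \<Rightarrow> 'a \<Rightarrow> vertex) \<Rightarrow> bool" where
  "reinforced_walk b c M X \<longleftrightarrow>
     prob_space M \<and>
     (\<forall>n. X n \<in> measurable M (count_space UNIV)) \<and>
     (AE \<omega> in M. X 0 \<omega> = []) \<and>
     (\<forall>x n y. \<P>(\<omega> in M. \<forall>i\<le>n. X i \<omega> = x i) > 0 \<longrightarrow>
        \<P>(\<omega> in M. X (Suc n) \<omega> = y \<bar> \<forall>i\<le>n. X i \<omega> = x i) = step_prob b c x n y)"

(* The logarithm of a probability, with log 0 = -\<infinity> (whereas ln 0 = 0). *)
definition log_prob :: "real \<Rightarrow> ereal" where
  "log_prob p = (if p = 0 then - \<infinity> else ereal (ln p))"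

end

theory Submission
  imports Defs "HOL-Real_Asymp.Real_Asymp"
begin

text \<open>
  The past is recorded only through the exit counts \<open>H x y\<close>, the number of moves from \<open>x\<close> to \<open>y\<close>
  made so far.  On a tree an edge hanging below the walker has been crossed equally often in
  both directions, and the edge above the walker once more downwards than upwards.  For \<open>c = 2\<close>
  the weight of the edge from \<open>x\<close> to a child \<open>y\<close> is therefore \<open>2 * (1/2 + H x y)\<close>, and to the parent
  \<open>2 * (1 + H x y)\<close>: every vertex carries its own Polya urn, and urns at different vertices do not
  interact.  This has two consequences that carry the whole proof.

  \<^item> Self-similarity.  When a vertex is hit for the first time, the walk below it is a copy of
    the whole walk whose root has an additional exit of weight 1, to its parent; this copy is
    killed when it uses that exit (\<open>payoff_below\<close>).

  \<^item> Exchangeability.  Drawing an extra ball from some urn and ignoring its colour does not change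
    the law of anything that happens later (\<open>payoff_mixing\<close>).  Hence being at
    the root at a given time and then behaving in a prescribed way has at most the probability
    that a fresh walk behaves in this way from the start.

  Let \<open>\<tau> k\<close> be the first time at height \<open>k\<close>, and let \<open>a = T + \<epsilon>\<close>.

  Existence of the rate.  Restarting the killed copy at the fresh vertex hit at time \<open>\<tau> k\<close> shows that
  its probability \<open>Q k n\<close> of reaching height \<open>k\<close> by time \<open>n\<close> satisfies
  \<open>Q k n * Q l m \<le> Q (k + l) (n + m)\<close> (\<open>hit_supermult\<close>), so its exponential rate along
  \<open>k = \<lceil>a * n\<rceil>\<close> exists by Fekete's lemma (\<open>killed_passage_rate\<close>).  Splitting a path at its last visit
  to the root, exchangeability gives \<open>P(\<tau> k \<le> n) \<le> (n + 1) * Q (k - 1) (n - 1)\<close>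
  (\<open>hit_le_hit_before_root\<close>).  The killed copy survives for ever with some probability \<open>q > 0\<close>:
  otherwise, again by exchangeability, the walk would be recurrent, against \<open>T > 0\<close>
  (\<open>survival_bounded_below\<close>).  Being still above height \<open>k\<close> at time \<open>n\<close> costs therefore at most a
  factor \<open>q\<close> compared with \<open>\<tau> k \<le> n\<close> (\<open>hit_le_above_at\<close>), and the probability of the theorem has the same
  rate as \<open>Q\<close>.

  Positivity of the rate.  For \<open>0 \<le> s \<le> 1\<close> put \<open>\<phi> k = E(s ^ \<tau> k)\<close>.  Then \<open>q * \<phi> (k + l) \<le> \<phi> k * \<phi> l\<close>
  (\<open>hit_submult\<close>).  Indeed, watched only while it is in the subtree of a vertex \<open>v\<close> of height \<open>k\<close>, the
  walk is a copy of the whole walk (colours drawn from an urn with one colour deleted are again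
  an urn), so \<open>\<phi> (k + l)\<close> is at most \<open>\<phi> l\<close> times the sum of \<open>E(s ^ \<tau> v)\<close> over all such \<open>v\<close>.  And \<open>q\<close> times
  this sum is at most \<open>\<phi> k\<close>, because each \<open>v\<close> that is hit is never left again with probability at least
  \<open>q\<close>, and this can happen to one \<open>v\<close> only.  The essential point is that the constant \<open>q\<close> does not
  degenerate as \<open>s\<close> tends to 1: the law of large numbers for a single block of large height \<open>k\<close>,
  with \<open>s = exp (- \<mu> / k)\<close>, makes \<open>\<phi> k / q\<close> at most half of what is needed, and submultiplicativity
  turns this factor into exponential decay (\<open>passage_exp_bound\<close>).
\<close>

section \<open>Exit counts and urns\<close>

type_synonym exits = "vertex \<Rightarrow> vertex \<Rightarrow> nat"

definition upd :: "exits \<Rightarrow> vertex \<Rightarrow> vertex \<Rightarrow> exits" where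
  "upd H x y = (\<lambda>x' y'. H x' y' + (if x' = x \<and> y' = y then 1 else 0))"

definition no_exits :: exits where "no_exits = (\<lambda>_ _. 0)"

text \<open>The subtree below \<open>v\<close> consists of the vertices \<open>z @ v\<close>; here it is identified with the whole
  tree, \<open>v\<close> becoming the root.\<close>
definition exits_in :: "vertex \<Rightarrow> exits \<Rightarrow> exits" where
  "exits_in v H = (\<lambda>z y. H (z @ v) (y @ v))"

definition below :: "vertex \<Rightarrow> vertex set" where
  "below v = {z @ v | z. True}"

definition prior :: "vertex \<Rightarrow> vertex \<Rightarrow> real" where
  "prior x y = (if length x < length y then 1/2 else 1)"

lemma upd_commute: "upd (upd H x y) z u = upd (upd H z u) x y"
  by (auto simp: upd_def fun_eq_iff)

lemma exits_in_upd: "exits_in v (upd H (z @ v) (y @ v)) = upd (exits_in v H) z y"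
  by (auto simp: upd_def exits_in_def fun_eq_iff)

lemma exits_in_upd_outside:
  assumes "x \<notin> below v \<or> y \<notin> below v"
  shows "exits_in v (upd H x y) = exits_in v H"
  using assms by (auto simp: upd_def exits_in_def fun_eq_iff below_def)

lemma below_append [simp]: "z @ v \<in> below v"
  by (auto simp: below_def)

lemma below_self [simp]: "v \<in> below v"
  using below_append[of "[]" v] by simp

lemma length_below: "x \<in> below v \<Longrightarrow> length v \<le> length x"
  by (auto simp: below_def)

lemma tl_notin_below: "v \<noteq> [] \<Longrightarrow> tl v \<notin> below v"
  using length_below[of "tl v" v] by (cases v) auto

locale reinforced_tree =
  fixes b :: nat
  assumes b_pos: "b > 0"
begin

definition nbr :: "vertex \<Rightarrow> vertex set" where
  "nbr x = (\<lambda>i. i # x) ` {..<b} \<union> (if x = [] then {} else {tl x})"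

text \<open>The parameter \<open>a\<close> is the weight of an additional exit of the root.  The reinforced walk has
  \<open>a = 0\<close>; a positive \<open>a\<close> occurs when the root stands for a vertex \<open>v\<close> of the tree, the additional
  exit being the one to the parent of \<open>v\<close>.  As no move of the walk uses it, the exit
  probabilities then sum to less than 1 at the root, and the missing mass is the probability
  of being killed.\<close>
definition urn :: "real \<Rightarrow> exits \<Rightarrow> vertex \<Rightarrow> real" where
  "urn a H x = (if x = [] then a else 0) + (\<Sum>z\<in>nbr x. prior x z + real (H x z))"

definition exit_prob :: "real \<Rightarrow> exits \<Rightarrow> vertex \<Rightarrow> vertex \<Rightarrow> real" where
  "exit_prob a H x y = (prior x y + real (H x y)) / urn a H x"

lemma finite_nbr [simp]: "finite (nbr x)"
  by (simp add: nbr_def)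

lemma nbr_nonempty: "nbr x \<noteq> {}"
  using b_pos by (auto simp: nbr_def)

lemma prior_pos: "prior x y > 0"
  by (simp add: prior_def)

lemma urn_pos: "a \<ge> 0 \<Longrightarrow> urn a H x > 0"
  unfolding urn_def
  by (rule add_nonneg_pos, simp, rule sum_pos)
    (auto simp: nbr_nonempty prior_pos add_pos_nonneg)

lemma exit_prob_pos: "a \<ge> 0 \<Longrightarrow> exit_prob a H x y > 0"
  unfolding exit_prob_def by (simp add: urn_pos prior_pos add_pos_nonneg)

lemmas exit_prob_nonneg = exit_prob_pos[THEN less_imp_le]

lemma sum_exit_prob: "(\<Sum>y\<in>nbr x. exit_prob 0 H x y) = 1"
  using urn_pos[of 0 H x] unfolding exit_prob_def sum_divide_distrib[symmetric]
  by (auto simp: urn_def)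

lemma sum_exit_prob_le_1:
  assumes "a \<ge> 0" "S \<subseteq> nbr x"
  shows "(\<Sum>y\<in>S. exit_prob a H x y) \<le> 1"
proof -
  have "(\<Sum>y\<in>S. exit_prob a H x y) \<le> (\<Sum>y\<in>nbr x. exit_prob a H x y)"
    using assms by (intro sum_mono2) (auto intro: exit_prob_nonneg)
  also have "\<dots> \<le> 1"
    using urn_pos[of a H x] assms unfolding exit_prob_def sum_divide_distrib[symmetric]
    by (auto simp: urn_def)
  finally show ?thesis .
qed

lemma urn_upd:
  assumes "y \<in> nbr x"
  shows "urn a (upd H x y) z = urn a H z + (if z = x then 1 else 0)"
proof -
  have "(\<Sum>u\<in>nbr z. prior z u + real (upd H x y z u))
      = (\<Sum>u\<in>nbr z. prior z u + real (H z u)) + (\<Sum>u\<in>nbr z. if z = x \<and> u = y then 1 else 0)"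
    by (simp add: sum.distrib[symmetric] upd_def) (rule sum.cong, auto)
  also have "(\<Sum>u\<in>nbr z. if z = x \<and> u = y then 1 else (0::real)) = (if z = x then 1 else 0)"
    using assms by (auto simp: if_distrib cong: if_cong)
  finally show ?thesis by (simp add: urn_def)
qed

text \<open>The exchangeability of the Polya urn: two consecutive draws, from one urn or from two,
  can be interchanged.\<close>
lemma exit_prob_swap:
  assumes "y \<in> nbr x" "u \<in> nbr z"
  shows "exit_prob a H x y * exit_prob a (upd H x y) z u = exit_prob a H z u * exit_prob a (upd H z u) x y"
  using assms by (cases "x = z"; simp add: exit_prob_def urn_upd; simp add: upd_def mult.commute)

lemma nbr_append:
  "nbr (z @ v) = (\<lambda>y. y @ v) ` nbr z \<union> (if z = [] \<and> v \<noteq> [] then {tl v} else {})"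
  by (auto simp: nbr_def image_iff)

lemma prior_append: "prior (z @ v) (y @ v) = prior z y"
  by (simp add: prior_def)

lemma sum_nbr_append:
  fixes f :: "vertex \<Rightarrow> real"
  assumes "v \<noteq> []"
  shows "(\<Sum>y\<in>nbr (z @ v). f y) = (\<Sum>y\<in>nbr z. f (y @ v)) + (if z = [] then f (tl v) else 0)"
proof -
  have inj: "inj_on (\<lambda>y. y @ v) (nbr z)" by (auto simp: inj_on_def)
  have "tl v \<notin> (\<lambda>y. y @ v) ` nbr z"
    using tl_notin_below[OF assms] by auto
  moreover have "sum f ((\<lambda>y. y @ v) ` nbr z) = (\<Sum>y\<in>nbr z. f (y @ v))"
    by (simp add: sum.reindex[OF inj])
  ultimately show ?thesis
    using assms by (cases "z = []") (auto simp: nbr_append simp del: append_Nil)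
qed

lemma urn_append:
  assumes "v \<noteq> []"
  shows "urn c H (z @ v) = urn (1 + real (H v (tl v))) (exits_in v H) z"
  using assms sum_nbr_append[OF assms, of "\<lambda>y. prior (z @ v) y + real (H (z @ v) y)" z]
  by (auto simp: urn_def exits_in_def prior_append) (auto simp: prior_def)

text \<open>Inside the subtree of \<open>v\<close> the walk moves as on the whole tree, the exit to the parent being
  counted as the additional exit of the root.\<close>
lemma exit_prob_append:
  assumes "v \<noteq> []"
  shows "exit_prob c H (z @ v) (y @ v) = exit_prob (1 + real (H v (tl v))) (exits_in v H) z y"
  using assms by (simp add: exit_prob_def urn_append prior_append exits_in_def)

text \<open>Conditionally on not moving to the parent, the choice among the children is made by the urn
  of the children alone, however often the parent was chosen before.\<close>
lemma exit_prob_append_reflect: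
  assumes "v \<noteq> []"
  shows "exit_prob c H (z @ v) (y @ v) =
    (1 - (if z = [] then exit_prob c H v (tl v) else 0)) * exit_prob 0 (exits_in v H) z y"
proof -
  have e: "urn c H v = urn 0 (exits_in v H) [] + (1 + real (H v (tl v)))"
    using urn_append[OF assms, of c H "[]"] by (simp add: urn_def)
  have p: "prior v (tl v) = 1" by (simp add: prior_def)
  have pos: "urn 0 (exits_in v H) [] > 0" by (rule urn_pos) simp
  have pos2: "urn c H v > 0" using e pos by linarith
  show ?thesis
  proof (cases "z = []")
    case True
    have "1 - exit_prob c H v (tl v) = urn 0 (exits_in v H) [] / urn c H v"
      using pos2 e by (simp add: exit_prob_def p field_simps)
    then show ?thesis using True pos pos2 prior_append[of "[]" v y]
      by (simp add: exit_prob_def exits_in_def)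
  next
    case False
    then show ?thesis using assms
      by (simp add: exit_prob_def urn_append prior_append exits_in_def) (simp add: urn_def)
  qed
qed

section \<open>Value functions and exchangeability\<close>

text \<open>All probabilities and expectations of the proof are values of one recursion.  The walk
  stops on entering \<open>B\<close> or after \<open>n\<close> steps and then earns \<open>t\<close> at its position, discounted by \<open>s\<close> per
  step; moves into \<open>A\<close> earn nothing.  The initial position is not tested for \<open>A\<close>, which allows
  for excursions from the root (\<open>A = {[]}\<close>).\<close>
fun payoff :: "real \<Rightarrow> real \<Rightarrow> vertex set \<Rightarrow> vertex set \<Rightarrow> (vertex \<Rightarrow> real)
    \<Rightarrow> nat \<Rightarrow> exits \<Rightarrow> vertex \<Rightarrow> real" where
  "payoff a s A B t 0 H x = t x"
| "payoff a s A B t (Suc n) H x = (if x \<in> B then t x else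
     s * (\<Sum>y\<in>nbr x - A. exit_prob a H x y * payoff a s A B t n (upd H x y) y))"

lemma payoff_nonneg:
  assumes "a \<ge> 0" "s \<ge> 0" "\<And>x. t x \<ge> 0"
  shows "payoff a s A B t n H x \<ge> 0"
  using assms by (induction n arbitrary: H x) (auto intro!: mult_nonneg_nonneg sum_nonneg exit_prob_nonneg)

lemma sum_exit_prob_mult_le:
  assumes "a \<ge> 0" "S \<subseteq> nbr x" "c \<ge> 0" "\<And>y. y \<in> S \<Longrightarrow> f y \<le> c"
  shows "(\<Sum>y\<in>S. exit_prob a H x y * f y) \<le> c"
proof -
  have "(\<Sum>y\<in>S. exit_prob a H x y * f y) \<le> (\<Sum>y\<in>S. exit_prob a H x y) * c"
    unfolding sum_distrib_right by (intro sum_mono mult_left_mono) (auto intro: assms exit_prob_nonneg)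
  also have "\<dots> \<le> 1 * c" by (intro mult_right_mono sum_exit_prob_le_1 assms)
  finally show ?thesis by simp
qed

lemma payoff_le_1:
  assumes "a \<ge> 0" "0 \<le> s" "s \<le> 1" "\<And>x. t x \<ge> 0" "\<And>x. t x \<le> 1"
  shows "payoff a s A B t n H x \<le> 1"
proof (induction n arbitrary: H x)
  case (Suc n)
  have "(\<Sum>y\<in>nbr x - A. exit_prob a H x y * payoff a s A B t n (upd H x y) y) \<le> 1"
    by (rule sum_exit_prob_mult_le) (auto intro: assms Suc)
  moreover have "0 \<le> (\<Sum>y\<in>nbr x - A. exit_prob a H x y * payoff a s A B t n (upd H x y) y)"
    by (intro sum_nonneg mult_nonneg_nonneg payoff_nonneg exit_prob_nonneg) (auto intro: assms)
  ultimately show ?case using assms by (auto intro: mult_le_one)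
qed (use assms in auto)

text \<open>An extra draw at \<open>x\<close> whose outcome is ignored has no influence on the future of the walk,
  wherever the walk is.  In terms of random environments: the conditional law of the
  environment is a martingale.  By \<open>exit_prob_swap\<close> the extra draw can be postponed until it is
  after the end of the walk.\<close>
lemma payoff_mixing:
  "(\<Sum>y\<in>nbr x. exit_prob 0 H x y * payoff 0 s A B t n (upd H x y) z) = payoff 0 s A B t n H z"
proof (induction n arbitrary: H z)
  case 0
  then show ?case by (simp add: sum_distrib_right[symmetric] sum_exit_prob)
next
  case (Suc n)
  let ?f = "payoff 0 s A B t n"
  show ?case
  proof (cases "z \<in> B")
    case True
    then show ?thesis by (simp add: sum_distrib_right[symmetric] sum_exit_prob)
  next
    case False
    have "(\<Sum>y\<in>nbr x. exit_prob 0 H x y * payoff 0 s A B t (Suc n) (upd H x y) z)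
      = s * (\<Sum>y\<in>nbr x. \<Sum>u\<in>nbr z - A. (exit_prob 0 H x y * exit_prob 0 (upd H x y) z u) * ?f (upd (upd H x y) z u) u)"
      using False by (simp add: sum_distrib_left mult_ac)
    also have "\<dots> = s * (\<Sum>u\<in>nbr z - A. \<Sum>y\<in>nbr x. (exit_prob 0 H z u * exit_prob 0 (upd H z u) x y) * ?f (upd (upd H z u) x y) u)"
      by (subst sum.swap) (intro arg_cong[where f = "(*) s"] sum.cong refl, simp add: exit_prob_swap upd_commute[of H x])
    also have "\<dots> = s * (\<Sum>u\<in>nbr z - A. exit_prob 0 H z u * ?f (upd H z u) u)"
      by (simp add: sum_distrib_left[symmetric] mult.assoc Suc)
    finally show ?thesis using False by simp
  qed
qed

section \<open>Hitting a height\<close>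

lemma sum_Diff_if:
  fixes f :: "vertex \<Rightarrow> real"
  assumes "finite S"
  shows "(\<Sum>y\<in>S - A. f y) = (\<Sum>y\<in>S. if y \<in> A then 0 else f y)"
  using assms by (intro sum.mono_neutral_cong_left) auto

text \<open>A walk that starts in the subtree of \<open>v\<close> can collect its payoff without using the exit from \<open>v\<close>
  to its parent, which bounds its value from below; if the parent is forbidden anyway, nothing
  is lost.\<close>
lemma payoff_below:
  assumes v: "v \<noteq> []" and s: "s \<ge> 0" and a: "a \<ge> 0" and t: "\<And>x. t x \<ge> 0"
  shows "payoff (1 + real (H v (tl v))) s {y. y @ v \<in> A} {y. y @ v \<in> B} (\<lambda>y. t (y @ v)) n (exits_in v H) z \<le> payoff a s A B t n H (z @ v)"
    and "tl v \<in> A \<Longrightarrow> payoff (1 + real (H v (tl v))) s {y. y @ v \<in> A} {y. y @ v \<in> B} (\<lambda>y. t (y @ v)) n (exits_in v H) z = payoff a s A B t n H (z @ v)"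
proof -
  let ?A' = "{y. y @ v \<in> A}" and ?B' = "{y. y @ v \<in> B}" and ?t' = "\<lambda>y. t (y @ v)"
  let ?p = "\<lambda>n H z. payoff (1 + real (H v (tl v))) s ?A' ?B' ?t' n (exits_in v H) z"
  let ?r = "\<lambda>n H. payoff a s A B t n H"
  have rec: "?r (Suc n) H (z @ v) = s * ((\<Sum>y\<in>nbr z - ?A'. exit_prob (1 + real (H v (tl v))) (exits_in v H) z y * ?r n (upd H (z @ v) (y @ v)) (y @ v))
      + (if z = [] \<and> tl v \<notin> A then exit_prob a H v (tl v) * ?r n (upd H v (tl v)) (tl v) else 0))"
    if "z \<notin> ?B'" for n H z
    using that sum_nbr_append[OF v, of "\<lambda>y. if y \<in> A then 0 else exit_prob a H (z @ v) y * ?r n (upd H (z @ v) y) y" z]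
    by (auto simp: sum_Diff_if exit_prob_append[OF v] cong: if_cong)
  have rec': "?p (Suc n) H z = s * (\<Sum>y\<in>nbr z - ?A'. exit_prob (1 + real (H v (tl v))) (exits_in v H) z y * ?p n (upd H (z @ v) (y @ v)) y)"
    if "z \<notin> ?B'" for n H z
  proof -
    have "upd H (z @ v) (y @ v) v (tl v) = H v (tl v)" for y
      using tl_notin_below[OF v] by (auto simp: upd_def below_def)
    then show ?thesis using that by (simp add: exits_in_upd)
  qed
  show "?p n H z \<le> ?r n H (z @ v)"
  proof (induction n arbitrary: H z)
    case (Suc n)
    show ?case
    proof (cases "z \<in> ?B'")
      case False
      show ?thesis unfolding rec[OF False] rec'[OF False]
        by (intro mult_left_mono s) (auto intro!: add_increasing2 sum_mono mult_left_mono Suc mult_nonneg_nonneg exit_prob_nonneg payoff_nonneg a s t)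
    qed simp
  qed simp
  show "?p n H z = ?r n H (z @ v)" if "tl v \<in> A"
  proof (induction n arbitrary: H z)
    case (Suc n)
    show ?case
    proof (cases "z \<in> ?B'")
      case False
      show ?thesis unfolding rec[OF False] rec'[OF False] using that
        by (simp add: Suc)
    qed simp
  qed simp
qed

definition reached :: "nat \<Rightarrow> vertex \<Rightarrow> real" where
  "reached k x = of_bool (k \<le> length x)"

text \<open>With \<open>s = 1\<close> this is the probability that height \<open>k\<close> is reached within \<open>n\<close> steps, and in general
  the expectation of \<open>s ^ \<tau> k\<close> on that event.\<close>
definition hit :: "real \<Rightarrow> real \<Rightarrow> nat \<Rightarrow> nat \<Rightarrow> exits \<Rightarrow> vertex \<Rightarrow> real" where
  "hit a s k = payoff a s {} {x. k \<le> length x} (reached k)"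

definition survival :: "real \<Rightarrow> nat \<Rightarrow> exits \<Rightarrow> vertex \<Rightarrow> real" where
  "survival a = payoff a 1 {} {} (\<lambda>_. 1)"

text \<open>The probability of being at height at least \<open>k\<close> after exactly \<open>n\<close> steps.\<close>
definition above_at :: "nat \<Rightarrow> nat \<Rightarrow> exits \<Rightarrow> vertex \<Rightarrow> real" where
  "above_at k = payoff 0 1 {} {} (reached k)"

definition hit_before_root :: "nat \<Rightarrow> nat \<Rightarrow> exits \<Rightarrow> vertex \<Rightarrow> real" where
  "hit_before_root k = payoff 0 1 {[]} {x. k \<le> length x} (reached k)"

lemma reached_bounds [simp]: "0 \<le> reached k x" "reached k x \<le> 1"
  by (auto simp: reached_def)

lemma hit_reached [simp]: "k \<le> length x \<Longrightarrow> hit a s k n H x = 1"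
  by (cases n) (auto simp: hit_def reached_def)

lemma hit_0: "length x < k \<Longrightarrow> hit a s k 0 H x = 0"
  by (auto simp: hit_def reached_def)

lemma hit_Suc: "length x < k \<Longrightarrow>
  hit a s k (Suc n) H x = s * (\<Sum>y\<in>nbr x. exit_prob a H x y * hit a s k n (upd H x y) y)"
  by (auto simp: hit_def)

lemma hit_nonneg: "a \<ge> 0 \<Longrightarrow> s \<ge> 0 \<Longrightarrow> hit a s k n H x \<ge> 0"
  unfolding hit_def by (rule payoff_nonneg) auto

lemma hit_le_1: "a \<ge> 0 \<Longrightarrow> s \<ge> 0 \<Longrightarrow> s \<le> 1 \<Longrightarrow> hit a s k n H x \<le> 1"
  unfolding hit_def by (rule payoff_le_1) auto

lemma hit_before_root_nonneg: "hit_before_root k n H x \<ge> 0"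
  unfolding hit_before_root_def by (rule payoff_nonneg) auto

lemma length_nbr: "y \<in> nbr x \<Longrightarrow> length y \<le> Suc (length x)"
  by (auto simp: nbr_def split: if_splits)

lemma payoff_mono_time:
  assumes "a \<ge> 0" "s \<ge> 0" "\<And>x. 0 \<le> t x" "\<And>x. x \<notin> B \<Longrightarrow> t x = 0"
  shows "payoff a s A B t n H x \<le> payoff a s A B t (Suc n) H x"
proof (induction n arbitrary: H x)
  case 0
  then show ?case
    using assms payoff_nonneg[of a s t A B "Suc 0" H x] by auto
next
  case (Suc n)
  show ?case
  proof (cases "x \<in> B")
    case False
    have "(\<Sum>y\<in>nbr x - A. exit_prob a H x y * payoff a s A B t n (upd H x y) y)
        \<le> (\<Sum>y\<in>nbr x - A. exit_prob a H x y * payoff a s A B t (Suc n) (upd H x y) y)"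
      by (intro sum_mono mult_left_mono Suc exit_prob_nonneg assms)
    then show ?thesis
      using False assms mult_left_mono[of _ _ s] by (simp del: payoff.simps add: payoff.simps(2)[of a s A B t n] payoff.simps(2)[of a s A B t "Suc n"])
  qed simp
qed

lemma hit_mono_time:
  assumes "a \<ge> 0" "s \<ge> 0" "n \<le> m"
  shows "hit a s k n H x \<le> hit a s k m H x"
proof -
  have "hit a s k n H x \<le> hit a s k (Suc n) H x" for n
    unfolding hit_def by (rule payoff_mono_time) (use assms in \<open>auto simp: reached_def\<close>)
  then show ?thesis using assms(3) by (rule lift_Suc_mono_le)
qed

lemma hit_before_root_mono_time: "hit_before_root k n H x \<le> hit_before_root k (Suc n) H x"
  unfolding hit_before_root_def by (rule payoff_mono_time) (auto simp: reached_def)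

lemma hit_antimono_level:
  assumes "a \<ge> 0" "k \<le> k'"
  shows "hit a 1 k' n H x \<le> hit a 1 k n H x"
proof (induction n arbitrary: H x)
  case 0
  then show ?case using assms by (auto simp: hit_def reached_def)
next
  case (Suc n)
  show ?case
  proof (cases "k \<le> length x")
    case True
    then show ?thesis using assms hit_le_1[of a 1 k' "Suc n" H x] by simp
  next
    case False
    then show ?thesis using assms
      by (simp add: hit_Suc) (intro sum_mono mult_left_mono Suc exit_prob_nonneg)
  qed
qed

definition fresh :: "nat \<Rightarrow> exits \<Rightarrow> bool" where
  "fresh k H \<longleftrightarrow> (\<forall>x y. k \<le> length x \<longrightarrow> H x y = 0)"

lemma fresh_upd: "fresh k H \<Longrightarrow> length x < k \<Longrightarrow> fresh k (upd H x y)"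
  by (auto simp: fresh_def upd_def)

lemma fresh_no_exits [simp]: "fresh k no_exits"
  by (auto simp: fresh_def no_exits_def)

lemma fresh_exits_in: "fresh k H \<Longrightarrow> k \<le> length v \<Longrightarrow> exits_in v H = no_exits"
  by (auto simp: fresh_def exits_in_def no_exits_def)

lemma fresh_exit: "fresh k H \<Longrightarrow> k \<le> length v \<Longrightarrow> H v y = 0"
  by (auto simp: fresh_def)

lemma hit_start_fresh:
  assumes "fresh (length x) H"
  shows "hit 1 1 l m no_exits [] \<le> hit 1 1 (length x + l) m H x"
proof (cases "x = []")
  case True
  then have "H = no_exits" using assms by (auto simp: fresh_def no_exits_def)
  then show ?thesis using True by simp
next
  case False
  have e: "(\<lambda>y. reached (length x + l) (y @ x)) = reached l"
    by (auto simp: reached_def)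
  show ?thesis
    using payoff_below(1)[OF False, of 1 1 "reached (length x + l)" H "{}" "{y. length x + l \<le> length y}" m "[]"] assms
    by (simp add: hit_def fresh_exits_in e fresh_exit)
qed

text \<open>At the time height \<open>k\<close> is reached the walk is at a fresh vertex; it suffices that it climbs
  another \<open>l\<close> levels without going back to the parent of this vertex.\<close>
lemma hit_supermult:
  assumes "fresh k H" "length x \<le> k"
  shows "hit 1 1 k n H x * hit 1 1 l m no_exits [] \<le> hit 1 1 (k + l) (n + m) H x"
  using assms
proof (induction n arbitrary: H x)
  case 0
  show ?case
  proof (cases "length x = k")
    case True
    then show ?thesis using hit_start_fresh[of x H] 0 by simp
  next
    case False
    then show ?thesis using 0 by (simp add: hit_0 hit_nonneg)
  qed
next
  case (Suc n)
  show ?case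
  proof (cases "length x = k")
    case True
    have "hit 1 1 (k + l) m H x \<le> hit 1 1 (k + l) (Suc n + m) H x"
      by (rule hit_mono_time) auto
    then show ?thesis using hit_start_fresh[of x H l m] Suc.prems True by simp
  next
    case False
    then have lt: "length x < k" using Suc.prems by simp
    show ?thesis using lt
      apply (simp add: hit_Suc sum_distrib_right mult.assoc)
      apply (intro sum_mono mult_left_mono Suc.IH exit_prob_nonneg fresh_upd Suc.prems)
      apply (auto dest: length_nbr)
      done
  qed
qed

text \<open>The first step leads from the root to a fresh vertex, and all of these are equivalent.  Until
  the walk returns to the root, it is the killed copy started one level higher.\<close>
lemma payoff_after_first_step:
  assumes "[] \<notin> B" "\<And>i y. y @ [i] \<in> B \<longleftrightarrow> y \<in> B'" "\<And>i y. t (y @ [i]) = t' y" "\<And>y. t y \<ge> 0"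
  shows "payoff 0 1 {[]} B t (Suc n) no_exits [] = payoff 1 1 {} B' t' n no_exits []"
proof -
  have "payoff 0 1 {[]} B t n (upd no_exits [] y) y = payoff 1 1 {} B' t' n no_exits []"
    if y: "y \<in> nbr []" for y
  proof -
    from y obtain i where i: "y = [i]" by (auto simp: nbr_def)
    show ?thesis
      using payoff_below(2)[of "[i]" 1 0 t "{[]}" "upd no_exits [] y" B n "[]"] assms i
      by (simp add: exits_in_def upd_def no_exits_def)
  qed
  moreover have "nbr [] - {[]} = nbr []" by (auto simp: nbr_def)
  ultimately show ?thesis
    using assms(1) sum_exit_prob[of no_exits "[]"] by (simp add: sum_distrib_right[symmetric])
qed

lemma hit_before_root_Suc: "hit_before_root (Suc k) (Suc n) no_exits [] = hit 1 1 k n no_exits []"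
  unfolding hit_before_root_def hit_def by (rule payoff_after_first_step) (auto simp: reached_def)

text \<open>Decomposition at the last visit to the root before height \<open>k\<close> is reached.  If there is one,
  there are at most \<open>n\<close> possible times for it, and after each of them the walk is, by exchangeability,
  no more likely to succeed than a walk from the root that has not spent this time.\<close>
lemma hit_le_hit_before_root:
  assumes "k \<ge> 1"
  shows "hit 0 1 k n H x \<le> hit_before_root k n H x + real n * hit_before_root k n H []"
proof (induction n arbitrary: H x)
  case 0
  then show ?case by (simp add: hit_def hit_before_root_def)
next
  case (Suc n)
  show ?case
  proof (cases "k \<le> length x")
    case True
    then have "hit_before_root k (Suc n) H x = 1" by (simp add: hit_before_root_def reached_def)
    then show ?thesis using True hit_before_root_nonneg[of k "Suc n" H "[]"] by simp
  next
    case False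
    \<comment> \<open>A move to the root opens a new decomposition and accounts for the additional summand.\<close>
    have step: "hit 0 1 k n (upd H x y) y \<le> (if y \<in> {[]} then 0 else hit_before_root k n (upd H x y) y)
        + real (Suc n) * hit_before_root k n (upd H x y) []" for y
      using Suc[of "upd H x y" y] hit_before_root_nonneg[of k n "upd H x y" "[]"]
      by (auto simp: algebra_simps)
    have "hit 0 1 k (Suc n) H x \<le> (\<Sum>y\<in>nbr x. exit_prob 0 H x y * ((if y \<in> {[]} then 0 else hit_before_root k n (upd H x y) y)
        + real (Suc n) * hit_before_root k n (upd H x y) []))"
      using False by (simp only: hit_Suc not_le mult_1_left) (intro sum_mono mult_left_mono step exit_prob_nonneg, simp)
    also have "\<dots> = (\<Sum>y\<in>nbr x. if y \<in> {[]} then 0 else exit_prob 0 H x y * hit_before_root k n (upd H x y) y)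
        + real (Suc n) * (\<Sum>y\<in>nbr x. exit_prob 0 H x y * hit_before_root k n (upd H x y) [])"
      unfolding sum_distrib_left sum.distrib[symmetric]
      by (intro sum.cong) (auto simp: algebra_simps)
    also have "(\<Sum>y\<in>nbr x. if y \<in> {[]} then 0 else exit_prob 0 H x y * hit_before_root k n (upd H x y) y) = hit_before_root k (Suc n) H x"
      using False unfolding hit_before_root_def by (simp add: sum_Diff_if)
    also have "(\<Sum>y\<in>nbr x. exit_prob 0 H x y * hit_before_root k n (upd H x y) []) = hit_before_root k n H []"
      unfolding hit_before_root_def by (rule payoff_mixing)
    finally show ?thesis
      using mult_left_mono[OF hit_before_root_mono_time[of k n H "[]"] of_nat_0_le_iff[of "Suc n"]] by linarith
  qed
qed

lemma hit_before_root_le_hit: "hit_before_root k n H x \<le> hit 0 1 k n H x"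
proof (induction n arbitrary: H x)
  case (Suc n)
  have "(\<Sum>y\<in>nbr x - {[]}. exit_prob 0 H x y * hit_before_root k n (upd H x y) y) \<le> (\<Sum>y\<in>nbr x - {[]}. exit_prob 0 H x y * hit 0 1 k n (upd H x y) y)"
    by (intro sum_mono mult_left_mono Suc exit_prob_nonneg) simp
  also have "\<dots> \<le> (\<Sum>y\<in>nbr x. exit_prob 0 H x y * hit 0 1 k n (upd H x y) y)"
    by (intro sum_mono2) (auto intro!: mult_nonneg_nonneg exit_prob_nonneg hit_nonneg)
  finally show ?case by (simp add: hit_def hit_before_root_def)
qed (simp add: hit_def hit_before_root_def)

lemma above_at_le_hit: "above_at k n H x \<le> hit 0 1 k n H x"
proof (induction n arbitrary: H x)
  case (Suc n)
  show ?case
  proof (cases "k \<le> length x")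
    case True
    then show ?thesis unfolding above_at_def hit_reached[OF True] by (intro payoff_le_1) auto
  next
    case False
    have "(\<Sum>y\<in>nbr x. exit_prob 0 H x y * above_at k n (upd H x y) y) \<le> (\<Sum>y\<in>nbr x. exit_prob 0 H x y * hit 0 1 k n (upd H x y) y)"
      by (intro sum_mono mult_left_mono Suc exit_prob_nonneg) simp
    then show ?thesis using False by (simp add: hit_def above_at_def)
  qed
qed (simp add: hit_def above_at_def)

text \<open>Once height \<open>k\<close> is reached, at a fresh vertex, the walk remains in the subtree of this vertex
  with probability at least \<open>q\<close>.\<close>
lemma hit_le_above_at:
  assumes "k \<ge> 1" "fresh k H" "length x \<le> k" and q: "\<And>m. q \<le> survival 1 m no_exits []"
  shows "q * hit 0 1 k n H x \<le> above_at k n H x"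
  using assms(2,3)
proof (induction n arbitrary: H x)
  case 0
  have "q \<le> 1" using q[of 0] by (simp add: survival_def)
  then show ?case by (simp add: hit_def above_at_def reached_def)
next
  case (Suc n)
  show ?case
  proof (cases "length x = k")
    case True
    then have ne: "x \<noteq> []" using assms(1) by auto
    have "reached k (y @ x) = 1" for y using True by (auto simp: reached_def)
    then have "survival 1 (Suc n) no_exits [] \<le> above_at k (Suc n) H x"
      using payoff_below(1)[OF ne, of 1 0 "reached k" H "{}" "{}" "Suc n" "[]"] Suc.prems True
      by (simp only: survival_def above_at_def) (simp add: fresh_exits_in fresh_exit)
    then show ?thesis using True q[of "Suc n"] by simp
  next
    case False
    then have lt: "length x < k" using Suc.prems by simp
    have "q * hit 0 1 k (Suc n) H x = (\<Sum>y\<in>nbr x. exit_prob 0 H x y * (q * hit 0 1 k n (upd H x y) y))"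
      using lt by (simp add: hit_Suc sum_distrib_left mult_ac)
    also have "\<dots> \<le> (\<Sum>y\<in>nbr x. exit_prob 0 H x y * above_at k n (upd H x y) y)"
      using lt Suc.prems by (intro sum_mono mult_left_mono Suc.IH exit_prob_nonneg fresh_upd) (auto dest: length_nbr)
    also have "\<dots> = above_at k (Suc n) H x" by (simp add: above_at_def)
    finally show ?thesis .
  qed
qed

section \<open>Submultiplicativity of the discounted passage times\<close>

definition level :: "nat \<Rightarrow> vertex set" where
  "level k = {v \<in> tree_vertices b. length v = k}"

text \<open>The expectation of \<open>s ^ \<tau> v\<close> on the event \<open>\<tau> v \<le> n\<close>, where \<open>\<tau> v\<close> is the first time at the
  vertex \<open>v\<close>.\<close>
definition discounted_visit :: "real \<Rightarrow> vertex \<Rightarrow> nat \<Rightarrow> exits \<Rightarrow> vertex \<Rightarrow> real" where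
  "discounted_visit s v = payoff 0 s {} {v} (\<lambda>x. of_bool (x = v))"

text \<open>The part of \<open>hit 0 s k\<close> in which height \<open>k\<close> is reached in the subtree of \<open>v\<close>.\<close>
definition hit_below :: "real \<Rightarrow> nat \<Rightarrow> vertex \<Rightarrow> nat \<Rightarrow> exits \<Rightarrow> vertex \<Rightarrow> real" where
  "hit_below s k v = payoff 0 s {} {x. k \<le> length x} (\<lambda>x. of_bool (k \<le> length x \<and> x \<in> below v))"

lemma finite_level [simp]: "finite (level k)"
proof -
  have "level k = {xs. set xs \<subseteq> {..<b} \<and> length xs = k}"
    by (auto simp: level_def tree_vertices_def)
  then show ?thesis by (simp add: finite_lists_length_eq)
qed

lemma nbr_in_tree: "x \<in> tree_vertices b \<Longrightarrow> y \<in> nbr x \<Longrightarrow> y \<in> tree_vertices b"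
  by (cases x) (auto simp: nbr_def tree_vertices_def)

lemma nbr_below:
  assumes "y \<in> nbr x" "x \<notin> below v" "y \<in> below v"
  shows "y = v"
proof -
  obtain z where z: "y = z @ v" using assms(3) by (auto simp: below_def)
  show ?thesis
  proof (cases z)
    case (Cons j z')
    from assms(1) consider i where "y = i # x" | "x \<noteq> []" "y = tl x" by (auto simp: nbr_def split: if_splits)
    then have "x \<in> below v"
    proof cases
      case 1
      then have "x = z' @ v" using z Cons by simp
      then show ?thesis by simp
    next
      case 2
      then have "x = (hd x # z) @ v" using z by (cases x) auto
      then show ?thesis by (metis below_append)
    qed
    then show ?thesis using assms(2) by simp
  qed (use z in simp)
qed

lemma hit_below_reached: "k \<le> length x \<Longrightarrow> hit_below s k v n H x = of_bool (x \<in> below v)"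
  by (cases n) (auto simp: hit_below_def)

lemma hit_below_Suc: "length x < k \<Longrightarrow>
  hit_below s k v (Suc n) H x = s * (\<Sum>y\<in>nbr x. exit_prob 0 H x y * hit_below s k v n (upd H x y) y)"
  by (auto simp: hit_below_def)

lemma hit_below_0: "length x < k \<Longrightarrow> hit_below s k v 0 H x = 0"
  by (auto simp: hit_below_def)

lemma hit_below_nonneg: "s \<ge> 0 \<Longrightarrow> hit_below s k v n H x \<ge> 0"
  unfolding hit_below_def by (rule payoff_nonneg) auto

lemma hit_le_sum_below:
  assumes "x \<in> tree_vertices b" "s \<ge> 0" "k \<le> m"
  shows "hit 0 s m n H x \<le> (\<Sum>v\<in>level k. hit_below s m v n H x)"
  using assms(1)
proof (induction n arbitrary: H x)
  have at_target: "hit 0 s m n H x \<le> (\<Sum>v\<in>level k. hit_below s m v n H x)"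
    if "x \<in> tree_vertices b" "m \<le> length x" for n H x
  proof -
    let ?v = "drop (length x - k) x"
    have "set ?v \<subseteq> set x" by (rule set_drop_subset)
    then have "?v \<in> level k"
      using that assms(3) by (auto simp: level_def tree_vertices_def)
    moreover have "x = take (length x - k) x @ ?v" by simp
    then have "x \<in> below ?v" by (metis below_append)
    ultimately have "1 \<le> (\<Sum>v\<in>level k. hit_below s m v n H x)"
      using member_le_sum[of ?v "level k" "\<lambda>v. hit_below s m v n H x"] that
      by (auto simp: hit_below_nonneg assms hit_below_reached)
    then show ?thesis using that by simp
  qed
  {
    case 0
    then show ?case
      using at_target[of x 0 H] by (cases "m \<le> length x") (simp_all add: hit_0 sum_nonneg hit_below_nonneg assms)
  next
    case (Suc n)
    show ?case
    proof (cases "m \<le> length x")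
      case False
      have "hit 0 s m (Suc n) H x \<le> s * (\<Sum>y\<in>nbr x. exit_prob 0 H x y * (\<Sum>v\<in>level k. hit_below s m v n (upd H x y) y))"
        using False by (simp add: hit_Suc)
          (intro mult_left_mono sum_mono Suc.IH nbr_in_tree[OF Suc.prems] exit_prob_nonneg assms, auto)
      also have "\<dots> = (\<Sum>v\<in>level k. hit_below s m v (Suc n) H x)"
        using False by (simp add: hit_below_Suc sum_distrib_left sum.swap[of _ "level k"])
      finally show ?thesis .
    qed (use at_target Suc.prems in blast)
  }
qed

text \<open>Watch the walk only while it is in the subtree of \<open>v\<close>; whenever it is outside, keep it waiting
  at \<open>v\<close>.  The watched walk is a reinforced walk by \<open>exit_prob_append_reflect\<close>, and the time spent
  outside only lowers the value because of \<open>s \<le> 1\<close>.\<close>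
lemma hit_below_le_hit:
  assumes v: "v \<noteq> []" and s: "0 \<le> s" "s \<le> 1" and nN: "n \<le> N"
  shows "hit_below s (length v + l) v n H (z @ v) \<le> hit 0 s l N (exits_in v H) z"
    and "x \<notin> below v \<Longrightarrow> hit_below s (length v + l) v n H x \<le> hit 0 s l N (exits_in v H) []"
  using nN
proof (induction n arbitrary: N H z x)
  case 0
  {
    case 1
    show ?case
      by (cases "l \<le> length z") (auto simp: hit_below_reached hit_below_0 hit_nonneg s)
  next
    case 2
    then show ?case
      using hit_nonneg[of 0 s] by (cases "length v + l \<le> length x") (auto simp: hit_below_reached hit_below_0 s)
  }
next
  case (Suc n)
  let ?k = "length v + l"
  {
    case 2
    show ?case
    proof (cases "?k \<le> length x")
      case True
      then show ?thesis using 2 hit_nonneg[of 0 s] s by (simp add: hit_below_reached)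
    next
      case False
      have "exit_prob 0 H x y * hit_below s ?k v n (upd H x y) y \<le> exit_prob 0 H x y * hit 0 s l N (exits_in v H) []"
        if "y \<in> nbr x" for y
      proof -
        have r: "exits_in v (upd H x y) = exits_in v H" using 2 by (simp add: exits_in_upd_outside)
        have "hit_below s ?k v n (upd H x y) y \<le> hit 0 s l N (exits_in v H) []"
        proof (cases "y \<in> below v")
          case True
          then have "y = v" using nbr_below that 2 by blast
          then show ?thesis using Suc.IH(1)[of N "upd H x y" "[]"] 2 r by simp
        next
          case False
          then show ?thesis using Suc.IH(2)[of y N "upd H x y"] 2 r by simp
        qed
        then show ?thesis by (intro mult_left_mono exit_prob_nonneg) simp_all
      qed
      then have "(\<Sum>y\<in>nbr x. exit_prob 0 H x y * hit_below s ?k v n (upd H x y) y) \<le> (\<Sum>y\<in>nbr x. exit_prob 0 H x y * hit 0 s l N (exits_in v H) [])"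
        by (intro sum_mono)
      also have "\<dots> = hit 0 s l N (exits_in v H) []"
        by (simp add: sum_distrib_right[symmetric] sum_exit_prob)
      finally have "s * (\<Sum>y\<in>nbr x. exit_prob 0 H x y * hit_below s ?k v n (upd H x y) y) \<le> s * hit 0 s l N (exits_in v H) []"
        using s by (intro mult_left_mono)
      also have "\<dots> \<le> hit 0 s l N (exits_in v H) []"
        using s hit_nonneg[of 0 s l N "exits_in v H" "[]"] by (simp add: mult_left_le_one_le)
      finally show ?thesis using False by (simp add: hit_below_Suc)
    qed
  next
    case 1
    then obtain N' where N': "N = Suc N'" "n \<le> N'" by (cases N) auto
    let ?h = "\<lambda>N H z. hit 0 s l N (exits_in v H) z"
    show ?case
    proof (cases "l \<le> length z")
      case True
      then show ?thesis by (simp add: hit_below_reached)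
    next
      case False
      \<comment> \<open>The probability of leaving the subtree, during which the watched walk does not move.\<close>
      define \<pi> where "\<pi> = (if z = [] then exit_prob 0 H v (tl v) else 0)"
      have \<pi>: "0 \<le> \<pi>" "\<pi> \<le> 1"
      proof -
        show "0 \<le> \<pi>" by (simp add: \<pi>_def exit_prob_nonneg)
        have "tl v \<in> nbr v" using v by (auto simp: nbr_def)
        then show "\<pi> \<le> 1" using sum_exit_prob_le_1[of 0 "{tl v}" v H] by (simp add: \<pi>_def)
      qed
      let ?S = "\<Sum>y\<in>nbr z. exit_prob 0 (exits_in v H) z y * hit 0 s l N' (upd (exits_in v H) z y) y"
      have S: "?h N H z = s * ?S" using False N' by (simp add: hit_Suc)
      have "(\<Sum>y\<in>nbr (z @ v). exit_prob 0 H (z @ v) y * hit_below s ?k v n (upd H (z @ v) y) y)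
         = (\<Sum>y\<in>nbr z. (1 - \<pi>) * exit_prob 0 (exits_in v H) z y * hit_below s ?k v n (upd H (z @ v) (y @ v)) (y @ v))
           + \<pi> * hit_below s ?k v n (upd H v (tl v)) (tl v)"
        by (simp add: sum_nbr_append[OF v] exit_prob_append_reflect[OF v] \<pi>_def)
      also have "\<dots> \<le> (\<Sum>y\<in>nbr z. (1 - \<pi>) * exit_prob 0 (exits_in v H) z y * hit 0 s l N' (upd (exits_in v H) z y) y)
           + \<pi> * ?h N H []"
      proof (intro add_mono sum_mono mult_left_mono)
        show "hit_below s ?k v n (upd H (z @ v) (y @ v)) (y @ v) \<le> hit 0 s l N' (upd (exits_in v H) z y) y" for y
          using Suc.IH(1)[of N' "upd H (z @ v) (y @ v)" y] N' by (simp add: exits_in_upd)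
        have "exits_in v (upd H v (tl v)) = exits_in v H"
          using tl_notin_below[OF v] by (simp add: exits_in_upd_outside)
        then show "hit_below s ?k v n (upd H v (tl v)) (tl v) \<le> ?h N H []"
          using Suc.IH(2)[OF tl_notin_below[OF v], of N "upd H v (tl v)"] 1 by simp
      qed (use \<pi> in \<open>auto intro!: mult_nonneg_nonneg exit_prob_nonneg\<close>)
      also have "\<dots> = (1 - \<pi>) * ?S + \<pi> * ?h N H []"
        by (simp add: sum_distrib_left mult_ac)
      finally have "hit_below s ?k v (Suc n) H (z @ v) \<le> s * ((1 - \<pi>) * ?S + \<pi> * ?h N H [])"
        using False s by (simp add: hit_below_Suc mult_left_mono)
      also have "\<dots> = (1 - \<pi>) * ?h N H z + s * (\<pi> * ?h N H z)"
      proof -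
        have "\<pi> * ?h N H [] = \<pi> * ?h N H z" by (simp add: \<pi>_def)
        then show ?thesis by (auto simp: S algebra_simps)
      qed
      also have "\<dots> \<le> (1 - \<pi>) * ?h N H z + 1 * (\<pi> * ?h N H z)"
        using s \<pi> by (intro add_left_mono mult_right_mono mult_nonneg_nonneg hit_nonneg) auto
      finally show ?thesis by (simp add: algebra_simps)
    qed
  }
qed

lemma discounted_visit_Suc: "x \<noteq> v \<Longrightarrow>
  discounted_visit s v (Suc n) H x = s * (\<Sum>y\<in>nbr x. exit_prob 0 H x y * discounted_visit s v n (upd H x y) y)"
  by (auto simp: discounted_visit_def)

lemma discounted_visit_self [simp]: "discounted_visit s v n H v = 1"
  by (cases n) (auto simp: discounted_visit_def)

lemma discounted_visit_0: "x \<noteq> v \<Longrightarrow> discounted_visit s v 0 H x = 0"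
  by (auto simp: discounted_visit_def)

lemma discounted_visit_nonneg: "s \<ge> 0 \<Longrightarrow> discounted_visit s v n H x \<ge> 0"
  unfolding discounted_visit_def by (rule payoff_nonneg) auto

lemma hit_below_le_discounted_visit:
  assumes v: "v \<noteq> []" and s: "0 \<le> s" "s \<le> 1" and nN: "n \<le> N"
    and "exits_in v H = no_exits" "x = v \<or> x \<notin> below v"
  shows "hit_below s (length v + l) v n H x \<le> discounted_visit s v n H x * hit 0 s l N no_exits []"
  using assms(4-6)
proof (induction n arbitrary: H x)
  case 0
  show ?case
  proof (cases "x = v")
    case True
    then show ?thesis using hit_below_le_hit(1)[OF v s, of 0 N l H "[]"] 0 by simp
  next
    case False
    then show ?thesis using 0 by (auto simp: hit_below_def discounted_visit_def)
  qed
next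
  case (Suc n)
  show ?case
  proof (cases "x = v")
    case True
    then show ?thesis using hit_below_le_hit(1)[OF v s, of "Suc n" N l H "[]"] Suc.prems by simp
  next
    case False
    then have x: "x \<notin> below v" using Suc.prems by simp
    show ?thesis
    proof (cases "length v + l \<le> length x")
      case True
      then show ?thesis
        using x by (simp add: hit_below_reached mult_nonneg_nonneg discounted_visit_nonneg hit_nonneg s)
    next
      case lt: False
      have "hit_below s (length v + l) v (Suc n) H x
         \<le> s * (\<Sum>y\<in>nbr x. exit_prob 0 H x y * (discounted_visit s v n (upd H x y) y * hit 0 s l N no_exits []))"
        using lt Suc.prems nbr_below[of _ x v] x
        by (simp add: hit_below_Suc)
          (intro mult_left_mono sum_mono Suc.IH exit_prob_nonneg s, auto simp: exits_in_upd_outside)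
      also have "\<dots> = discounted_visit s v (Suc n) H x * hit 0 s l N no_exits []"
        using False by (simp add: discounted_visit_Suc sum_distrib_left sum_distrib_right mult_ac)
      finally show ?thesis .
    qed
  qed
qed

lemma survival_Suc: "survival a (Suc n) H x = (\<Sum>y\<in>nbr x. exit_prob a H x y * survival a n (upd H x y) y)"
  by (simp add: survival_def)

lemma survival_0: "survival a 0 H x = 1"
  by (simp add: survival_def)

lemma below_same_length: "x \<in> below u \<Longrightarrow> length x = length u \<Longrightarrow> x = u"
  by (auto simp: below_def)

definition untouched :: "vertex \<Rightarrow> exits \<Rightarrow> bool" where
  "untouched v H \<longleftrightarrow> (\<forall>x\<in>below v. \<forall>y. H x y = 0)"

lemma untouched_upd: "untouched v H \<Longrightarrow> x \<notin> below v \<Longrightarrow> untouched v (upd H x y)"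
  by (auto simp: untouched_def upd_def)

lemma untouched_exits_in: "untouched v H \<Longrightarrow> exits_in v H = no_exits"
  by (auto simp: untouched_def exits_in_def no_exits_def)

text \<open>Let \<open>V\<close> be a set of untouched vertices of height \<open>k\<close>.  The expected number of those that will be
  visited is at most \<open>1/q\<close>.  Indeed, let \<open>E\<close> be the supremum of such expectations.  When some \<open>u \<in> V\<close> is
  hit, the others can be visited only if the walk leaves the subtree of \<open>u\<close> again, which has
  probability at most \<open>1 - q\<close>; so \<open>E \<le> 1 + (1 - q) * E\<close>.  For the induction this is combined with a
  bound for a walk that is currently in the subtree of a vertex \<open>u\<close> outside \<open>V\<close>, namely the
  probability of leaving that subtree in time.\<close>
lemma expected_visits:
  assumes k: "k > 0" and s: "0 \<le> s" "s \<le> 1" and q: "0 \<le> q" "\<And>m. q \<le> survival 1 m no_exits []"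
    and "finite V" "\<forall>v\<in>V. length v = k \<and> untouched v H \<and> x \<notin> below v"
  shows "q * (\<Sum>v\<in>V. discounted_visit s v n H x) \<le> 1 \<and>
    (\<forall>u z. x = z @ u \<longrightarrow> length u = k \<longrightarrow> u \<notin> V \<longrightarrow>
      q * (\<Sum>v\<in>V. discounted_visit s v n H x) \<le> 1 - survival (1 + real (H u (tl u))) n (exits_in u H) z)"
  using assms(6,7)
proof (induction n arbitrary: H x V)
  case 0
  then have "(\<Sum>v\<in>V. discounted_visit s v 0 H x) = 0"
    by (intro sum.neutral ballI) (auto intro!: discounted_visit_0)
  then show ?case unfolding survival_0 by (intro conjI allI impI) simp_all
next
  case (Suc n)
  let ?R = "\<lambda>n H x. q * (\<Sum>v\<in>V. discounted_visit s v n H x)"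
  have step: "?R (Suc n) H x \<le> (\<Sum>y\<in>nbr x. exit_prob 0 H x y * ?R n (upd H x y) y)"
  proof -
    have "?R (Suc n) H x = q * (\<Sum>v\<in>V. s * (\<Sum>y\<in>nbr x. exit_prob 0 H x y * discounted_visit s v n (upd H x y) y))"
      using Suc.prems by (intro arg_cong[where f = "(*) q"] sum.cong refl discounted_visit_Suc) auto
    also have "\<dots> = s * (\<Sum>y\<in>nbr x. exit_prob 0 H x y * ?R n (upd H x y) y)"
      by (simp add: sum_distrib_left mult_ac sum.swap[of _ V])
    also have "\<dots> \<le> 1 * (\<Sum>y\<in>nbr x. exit_prob 0 H x y * ?R n (upd H x y) y)"
      using s q by (intro mult_right_mono sum_nonneg mult_nonneg_nonneg exit_prob_nonneg discounted_visit_nonneg) auto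
    finally show ?thesis by simp
  qed
  have unt: "untouched v (upd H x y)" if "v \<in> V" for v y
    using that Suc.prems by (auto intro: untouched_upd)
  have outside: "y = v" if "v \<in> V" "y \<in> nbr x" "y \<in> below v" for v y
    using nbr_below[of y x v] that Suc.prems by auto
  have one: "?R n (upd H x y) y \<le> 1" if y: "y \<in> nbr x" for y
  proof (cases "y \<in> V")
    case True
    let ?V = "V - {y}"
    have "y \<notin> below v" if "v \<in> ?V" for v
      using outside[of v y] that y by auto
    then have "q * (\<Sum>v\<in>?V. discounted_visit s v n (upd H x y) y)
        \<le> 1 - survival (1 + real (upd H x y y (tl y))) n (exits_in y (upd H x y)) []"
      using Suc.IH[of ?V "upd H x y" y] Suc.prems unt True by auto
    also have "upd H x y y (tl y) = 0"
      using unt[OF True] by (auto simp: untouched_def)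
    also have "exits_in y (upd H x y) = no_exits"
      using unt[OF True] by (rule untouched_exits_in)
    finally have "q * (\<Sum>v\<in>?V. discounted_visit s v n (upd H x y) y) \<le> 1 - q"
      using q(2)[of n] by simp
    moreover have "(\<Sum>v\<in>V. discounted_visit s v n (upd H x y) y) = 1 + (\<Sum>v\<in>?V. discounted_visit s v n (upd H x y) y)"
      using True Suc.prems by (simp add: sum.remove)
    ultimately show ?thesis by (simp add: algebra_simps)
  next
    case False
    have "y \<notin> below v" if "v \<in> V" for v
      using outside[of v y] that y False by auto
    then show ?thesis using Suc.IH[of V "upd H x y" y] Suc.prems unt by auto
  qed
  have "?R (Suc n) H x \<le> 1"
    using step sum_exit_prob_mult_le[of 0 "nbr x" x 1 "\<lambda>y. ?R n (upd H x y) y" H] one by auto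
  moreover have "?R (Suc n) H x \<le> 1 - survival (1 + real (H u (tl u))) (Suc n) (exits_in u H) z"
    if x: "x = z @ u" and u: "length u = k" "u \<notin> V" for u z
  proof -
    have ne: "u \<noteq> []" using u k by auto
    let ?a = "1 + real (H u (tl u))"
    have bound: "?R n (upd H x (y @ u)) (y @ u) \<le> 1 - survival ?a n (upd (exits_in u H) z y) y" if y: "y \<in> nbr z" for y
    proof -
      have yn: "y @ u \<in> nbr x" using y x by (auto simp: nbr_append)
      have "y @ u \<notin> below v" if v: "v \<in> V" for v
      proof
        assume "y @ u \<in> below v"
        then have "y @ u = v" using outside[OF v yn] by simp
        then have "u = v" using u v Suc.prems by (cases y) auto
        then show False using u v by simp
      qed
      then have "?R n (upd H x (y @ u)) (y @ u)
        \<le> 1 - survival (1 + real (upd H x (y @ u) u (tl u))) n (exits_in u (upd H x (y @ u))) y"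
        using Suc.IH[of V "upd H x (y @ u)" "y @ u"] Suc.prems unt u by auto
      moreover have "upd H x (y @ u) u (tl u) = H u (tl u)"
        using tl_notin_below[OF ne] by (auto simp: upd_def below_def)
      ultimately show ?thesis using x by (simp add: exits_in_upd)
    qed
    have "(\<Sum>y\<in>nbr x. exit_prob 0 H x y * ?R n (upd H x y) y)
      = (\<Sum>y\<in>nbr z. exit_prob 0 H (z @ u) (y @ u) * ?R n (upd H x (y @ u)) (y @ u))
        + (if z = [] then exit_prob 0 H x (tl u) * ?R n (upd H x (tl u)) (tl u) else 0)"
      unfolding x by (rule sum_nbr_append[OF ne])
    also have "\<dots> \<le> (\<Sum>y\<in>nbr z. exit_prob 0 H (z @ u) (y @ u) * (1 - survival ?a n (upd (exits_in u H) z y) y))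
        + (if z = [] then exit_prob 0 H x (tl u) * 1 else 0)"
    proof (intro add_mono sum_mono mult_left_mono)
      show "(if z = [] then exit_prob 0 H x (tl u) * ?R n (upd H x (tl u)) (tl u) else 0)
        \<le> (if z = [] then exit_prob 0 H x (tl u) * 1 else 0)"
      proof (cases "z = []")
        case True
        have "tl u \<in> nbr x" using True x ne by (auto simp: nbr_def)
        then show ?thesis using one True mult_left_mono[OF one exit_prob_nonneg] by simp
      qed simp
    qed (auto intro: bound exit_prob_nonneg)
    also have "\<dots> = (\<Sum>y\<in>nbr x. exit_prob 0 H x y) - (\<Sum>y\<in>nbr z. exit_prob 0 H (z @ u) (y @ u) * survival ?a n (upd (exits_in u H) z y) y)"
      unfolding x sum_nbr_append[OF ne] by (simp add: right_diff_distrib sum_subtractf)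
    also have "\<dots> = 1 - survival ?a (Suc n) (exits_in u H) z"
      by (simp add: sum_exit_prob survival_Suc exit_prob_append[OF ne])
    finally show ?thesis using step by linarith
  qed
  ultimately show ?case by blast
qed

text \<open>The argument of \<open>expected_visits\<close>, started before height \<open>k\<close> is reached for the first time;
  every discount factor \<open>s ^ \<tau> v\<close> is at most \<open>s ^ \<tau> k\<close>.\<close>
lemma expected_visits_le_hit:
  assumes k: "k > 0" and s: "0 \<le> s" "s \<le> 1" and q: "0 \<le> q" "\<And>m. q \<le> survival 1 m no_exits []"
    and "fresh k H" "length x < k"
  shows "q * (\<Sum>v\<in>level k. discounted_visit s v n H x) \<le> hit 0 s k n H x"
  using assms(6,7)
proof (induction n arbitrary: H x)
  case 0
  then have "(\<Sum>v\<in>level k. discounted_visit s v 0 H x) = 0"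
    by (intro sum.neutral ballI) (auto intro!: discounted_visit_0 simp: level_def)
  then show ?case using 0 by (simp add: hit_0)
next
  case (Suc n)
  let ?R = "\<lambda>n H x. q * (\<Sum>v\<in>level k. discounted_visit s v n H x)"
  have ne: "x \<noteq> v" if "v \<in> level k" for v using that Suc.prems by (auto simp: level_def)
  have "?R (Suc n) H x = q * (\<Sum>v\<in>level k. s * (\<Sum>y\<in>nbr x. exit_prob 0 H x y * discounted_visit s v n (upd H x y) y))"
    by (intro arg_cong[where f = "(*) q"] sum.cong refl discounted_visit_Suc) (auto simp: ne)
  also have "\<dots> = s * (\<Sum>y\<in>nbr x. exit_prob 0 H x y * ?R n (upd H x y) y)"
    by (simp add: sum_distrib_left mult_ac sum.swap[of _ "level k"])
  also have "\<dots> \<le> s * (\<Sum>y\<in>nbr x. exit_prob 0 H x y * hit 0 s k n (upd H x y) y)"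
  proof (intro mult_left_mono sum_mono s exit_prob_nonneg)
    fix y assume y: "y \<in> nbr x"
    have fr: "fresh k (upd H x y)" using Suc.prems by (intro fresh_upd)
    show "?R n (upd H x y) y \<le> hit 0 s k n (upd H x y) y"
    proof (cases "length y < k")
      case True
      then show ?thesis using Suc.IH fr by simp
    next
      case False
      then have len: "length y = k" using length_nbr[OF y] Suc.prems by simp
      have unt: "untouched v (upd H x y)" if "length v = k" for v
        using fr that length_below by (auto simp: untouched_def fresh_def)
      let ?V = "level k - {y}"
      have "\<forall>v\<in>?V. length v = k \<and> untouched v (upd H x y) \<and> y \<notin> below v"
      proof
        fix v assume "v \<in> ?V"
        then have "length v = k" "v \<noteq> y" by (auto simp: level_def)
        then show "length v = k \<and> untouched v (upd H x y) \<and> y \<notin> below v"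
          using unt[of v] len below_same_length[of y v] by auto
      qed
      from expected_visits[OF k s q _ this, of n]
      have "q * (\<Sum>v\<in>?V. discounted_visit s v n (upd H x y) y)
          \<le> 1 - survival (1 + real (upd H x y y (tl y))) n (exits_in y (upd H x y)) []"
        using len by auto
      also have "upd H x y y (tl y) = 0"
        using unt[OF len] by (auto simp: untouched_def)
      also have "exits_in y (upd H x y) = no_exits"
        using unt[OF len] by (rule untouched_exits_in)
      finally have 1: "q * (\<Sum>v\<in>?V. discounted_visit s v n (upd H x y) y) \<le> 1 - q"
        using q(2)[of n] by simp
      have "(\<Sum>v\<in>level k. discounted_visit s v n (upd H x y) y) \<le> 1 + (\<Sum>v\<in>?V. discounted_visit s v n (upd H x y) y)"
        by (cases "y \<in> level k") (simp_all add: sum.remove)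
      from mult_left_mono[OF this q(1)] 1 show ?thesis
        using len by (simp add: algebra_simps)
    qed
  qed simp
  also have "\<dots> = hit 0 s k (Suc n) H x"
    using Suc.prems by (simp add: hit_Suc)
  finally show ?case .
qed

text \<open>This holds with the same \<open>q\<close> for all discount factors \<open>s\<close>, which is what makes it useful when \<open>s\<close>
  is close to 1.\<close>
lemma hit_submult:
  assumes k: "k > 0" and s: "0 \<le> s" "s \<le> 1" and q: "0 \<le> q" "\<And>m. q \<le> survival 1 m no_exits []"
  shows "q * hit 0 s (k + l) n no_exits [] \<le> hit 0 s k n no_exits [] * hit 0 s l n no_exits []"
proof -
  let ?h = "hit 0 s l n no_exits []"
  have h: "?h \<ge> 0" using s by (intro hit_nonneg) auto
  have "hit 0 s (k + l) n no_exits [] \<le> (\<Sum>v\<in>level k. hit_below s (k + l) v n no_exits [])"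
    using s by (intro hit_le_sum_below) (auto simp: tree_vertices_def)
  also have "\<dots> \<le> (\<Sum>v\<in>level k. discounted_visit s v n no_exits [] * ?h)"
  proof (rule sum_mono)
    fix v assume v: "v \<in> level k"
    then have "length v = k" "v \<noteq> []" using k by (auto simp: level_def)
    moreover have "[] \<notin> below v" using \<open>v \<noteq> []\<close> by (auto simp: below_def)
    ultimately show "hit_below s (k + l) v n no_exits [] \<le> discounted_visit s v n no_exits [] * ?h"
      using hit_below_le_discounted_visit[of v s n n no_exits "[]" l] s
      by (simp add: exits_in_def no_exits_def)
  qed
  also have "\<dots> = (\<Sum>v\<in>level k. discounted_visit s v n no_exits []) * ?h"
    by (simp add: sum_distrib_right)
  finally have "q * hit 0 s (k + l) n no_exits [] \<le> q * ((\<Sum>v\<in>level k. discounted_visit s v n no_exits []) * ?h)"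
    using q by (intro mult_left_mono)
  also have "\<dots> = (q * (\<Sum>v\<in>level k. discounted_visit s v n no_exits [])) * ?h" by simp
  also have "\<dots> \<le> hit 0 s k n no_exits [] * ?h"
    using k s q h by (intro mult_right_mono expected_visits_le_hit) auto
  finally show ?thesis .
qed

text \<open>The exponential Markov inequality.\<close>
lemma hit_discount_ge:
  assumes "0 \<le> s" "s \<le> 1"
  shows "s ^ n * hit 0 1 k n H x \<le> hit 0 s k n H x"
proof (induction n arbitrary: H x)
  case (Suc n)
  show ?case
  proof (cases "k \<le> length x")
    case True
    then show ?thesis using assms by (simp add: power_le_one mult_le_one del: power_Suc)
  next
    case False
    have "s ^ Suc n * hit 0 1 k (Suc n) H x = s * (\<Sum>y\<in>nbr x. exit_prob 0 H x y * (s ^ n * hit 0 1 k n (upd H x y) y))"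
      using False by (simp add: hit_Suc sum_distrib_left mult_ac)
    also have "\<dots> \<le> s * (\<Sum>y\<in>nbr x. exit_prob 0 H x y * hit 0 s k n (upd H x y) y)"
      by (intro mult_left_mono sum_mono Suc exit_prob_nonneg assms) simp
    finally show ?thesis using False by (simp add: hit_Suc)
  qed
qed (simp add: hit_def)

text \<open>Either \<open>\<tau> k \<le> m\<close>, or \<open>s ^ \<tau> k \<le> s ^ (m + 1)\<close>.\<close>
lemma hit_discount_le:
  assumes "0 \<le> s" "s \<le> 1"
  shows "hit 0 s k n H x \<le> hit 0 1 k m H x + s ^ Suc m"
proof (induction n arbitrary: m H x)
  case 0
  then show ?case
    using assms hit_nonneg[of 0 1 k m H x] by (cases "k \<le> length x") (auto simp: hit_0)
next
  case (Suc n)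
  show ?case
  proof (cases "k \<le> length x")
    case True
    then show ?thesis using assms by simp
  next
    case False
    let ?S = "\<lambda>s n. \<Sum>y\<in>nbr x. exit_prob 0 H x y * hit 0 s k n (upd H x y) y"
    have S1: "?S s n \<le> 1"
      using assms by (intro sum_exit_prob_mult_le hit_le_1) auto
    show ?thesis
    proof (cases m)
      case 0
      then show ?thesis using False S1 assms mult_left_mono[of "?S s n" 1 s] by (simp add: hit_Suc hit_0)
    next
      case (Suc m')
      have "?S s n \<le> (\<Sum>y\<in>nbr x. exit_prob 0 H x y * (hit 0 1 k m' (upd H x y) y + s ^ Suc m'))"
        by (intro sum_mono mult_left_mono Suc.IH exit_prob_nonneg) simp
      also have "\<dots> = ?S 1 m' + s ^ Suc m'"
        by (simp add: distrib_left sum.distrib sum_distrib_right[symmetric] sum_exit_prob del: power_Suc)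
      finally have "s * ?S s n \<le> s * ?S 1 m' + s * s ^ Suc m'"
        using assms by (simp only: distrib_left[symmetric]) (rule mult_left_mono)
      also have "s * ?S 1 m' \<le> 1 * ?S 1 m'"
        using assms by (intro mult_right_mono sum_nonneg mult_nonneg_nonneg exit_prob_nonneg hit_nonneg) auto
      finally show ?thesis using False Suc by (simp add: hit_Suc)
    qed
  qed
qed

end

section \<open>From the reinforced walk to its value functions\<close>

definition exits_upto :: "(nat \<Rightarrow> vertex) \<Rightarrow> nat \<Rightarrow> exits" where
  "exits_upto x n = (\<lambda>u w. card {i. i < n \<and> x i = u \<and> x (Suc i) = w})"

lemma exits_upto_0: "exits_upto x 0 = no_exits"
  by (simp add: exits_upto_def no_exits_def)

lemma exits_upto_Suc: "exits_upto x (Suc n) = upd (exits_upto x n) (x n) (x (Suc n))"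
proof (intro ext)
  fix u w
  have "{i. i < Suc n \<and> x i = u \<and> x (Suc i) = w} =
    {i. i < n \<and> x i = u \<and> x (Suc i) = w} \<union> (if x n = u \<and> x (Suc n) = w then {n} else {})"
    by (auto simp: less_Suc_eq)
  then show "exits_upto x (Suc n) u w = upd (exits_upto x n) (x n) (x (Suc n)) u w"
    by (auto simp: exits_upto_def upd_def)
qed

lemma exits_upto_cong: "(\<And>i. i \<le> n \<Longrightarrow> x i = x' i) \<Longrightarrow> exits_upto x n = exits_upto x' n"
  by (induction n) (simp_all add: exits_upto_0 exits_upto_Suc)

lemma card_crossings:
  assumes "u \<noteq> w"
  shows "card {i. i < n \<and> {x i, x (Suc i)} = {u, w}} = exits_upto x n u w + exits_upto x n w u"
proof -
  have "{i. i < n \<and> {x i, x (Suc i)} = {u, w}} =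
    {i. i < n \<and> x i = u \<and> x (Suc i) = w} \<union> {i. i < n \<and> x i = w \<and> x (Suc i) = u}"
    by (auto simp: doubleton_eq_iff)
  also have "card \<dots> = exits_upto x n u w + exits_upto x n w u"
    unfolding exits_upto_def using assms by (intro card_Un_disjoint) auto
  finally show ?thesis .
qed

context reinforced_tree
begin

definition tree_walk :: "(nat \<Rightarrow> vertex) \<Rightarrow> nat \<Rightarrow> bool" where
  "tree_walk x n \<longleftrightarrow> x 0 = [] \<and> (\<forall>i<n. x (Suc i) \<in> nbr (x i))"

lemma tree_walk_in_tree: "tree_walk x n \<Longrightarrow> x n \<in> tree_vertices b"
proof (induction n)
  case (Suc n)
  then have "x n \<in> tree_vertices b" "x (Suc n) \<in> nbr (x n)" by (auto simp: tree_walk_def)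
  then show ?case by (rule nbr_in_tree)
qed (simp add: tree_walk_def tree_vertices_def)

lemma below_Cons: "y # x \<in> below v \<longleftrightarrow> x \<in> below v \<or> v = y # x"
proof
  assume "y # x \<in> below v"
  then obtain z where "y # x = z @ v" by (auto simp: below_def)
  then show "x \<in> below v \<or> v = y # x" by (cases z) auto
next
  assume "x \<in> below v \<or> v = y # x"
  then show "y # x \<in> below v"
  proof
    assume "x \<in> below v"
    then obtain z where "x = z @ v" by (auto simp: below_def)
    then show ?thesis using below_append[of "y # z" v] by simp
  next
    assume "v = y # x"
    then show ?thesis using below_self[of "y # x"] by simp
  qed
qed

text \<open>The edge above \<open>i # u\<close> is crossed downwards and upwards alternately.\<close>
lemma crossings_balance:
  assumes "tree_walk x n"
  shows "exits_upto x n u (i # u) = exits_upto x n (i # u) u + of_bool (x n \<in> below (i # u))"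
  using assms
proof (induction n)
  case 0
  then show ?case by (auto simp: exits_upto_0 no_exits_def tree_walk_def below_def)
next
  case (Suc n)
  then have IH: "exits_upto x n u (i # u) = exits_upto x n (i # u) u + of_bool (x n \<in> below (i # u))"
    and "x (Suc n) \<in> nbr (x n)" by (auto simp: tree_walk_def)
  then consider j where "x (Suc n) = j # x n" | j where "x n = j # x (Suc n)"
    by (cases "x n") (auto simp: nbr_def)
  then show ?case
  proof cases
    case 1
    have "x n \<notin> below (j # x n)" using length_below by fastforce
    then show ?thesis using IH 1 by (auto simp: exits_upto_Suc upd_def below_Cons)
  next
    case 2
    have "x (Suc n) \<notin> below (j # x (Suc n))" using length_below by fastforce
    then show ?thesis using IH 2 by (auto simp: exits_upto_Suc upd_def below_Cons)
  qed
qed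

lemma edge_weight_eq:
  assumes "tree_walk x n" "y \<in> nbr (x n)"
  shows "edge_weight 2 x {x n, y} n = 2 * (prior (x n) y + real (exits_upto x n (x n) y))"
proof -
  from assms(2) consider j where "y = j # x n" | j where "x n = j # y"
    by (cases "x n") (auto simp: nbr_def)
  then show ?thesis
  proof cases
    case 1
    have "x n \<notin> below (j # x n)" using length_below by fastforce
    then show ?thesis using crossings_balance[OF assms(1), of "x n" j] 1
      by (simp add: edge_weight_def card_crossings prior_def)
  next
    case 2
    have "x n \<noteq> y" using 2 by simp
    then show ?thesis using crossings_balance[OF assms(1), of y j] 2 card_crossings[of "x n" y n x]
      by (simp add: edge_weight_def prior_def)
  qed
qed

lemma step_prob_eq:
  assumes "tree_walk x n"
  shows "step_prob b 2 x n y = (if y \<in> nbr (x n) then exit_prob 0 (exits_upto x n) (x n) y else 0)"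
proof -
  have adj: "tree_adj b (x n) z \<longleftrightarrow> z \<in> nbr (x n)" for z
    using tree_walk_in_tree[OF assms] by (cases "x n") (auto simp: tree_adj_def nbr_def tree_vertices_def)
  then have C: "Collect (tree_adj b (x n)) = nbr (x n)" by auto
  have S: "(\<Sum>z\<in>nbr (x n). edge_weight 2 x {x n, z} n)
      = 2 * (\<Sum>z\<in>nbr (x n). prior (x n) z + real (exits_upto x n (x n) z))"
    unfolding sum_distrib_left by (rule sum.cong) (simp_all only: edge_weight_eq[OF assms])
  show ?thesis
  proof (cases "y \<in> nbr (x n)")
    case True
    have "step_prob b 2 x n y = edge_weight 2 x {x n, y} n / (\<Sum>z\<in>nbr (x n). edge_weight 2 x {x n, z} n)"
      by (simp add: step_prob_def adj C True)
    also have "\<dots> = exit_prob 0 (exits_upto x n) (x n) y"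
      unfolding S edge_weight_eq[OF assms True] exit_prob_def urn_def by (simp del: distrib_left_numeral)
    finally show ?thesis using True by simp
  qed (simp add: step_prob_def adj)
qed

text \<open>The probability that the walk, being at \<open>x\<close> at time \<open>m\<close>, is in \<open>C i\<close> at all times \<open>i\<close> from \<open>m\<close> to
  \<open>m + n\<close>.  Events of this form suffice to pass from the given probability space to the recursion.\<close>
fun box :: "(nat \<Rightarrow> vertex set) \<Rightarrow> nat \<Rightarrow> nat \<Rightarrow> exits \<Rightarrow> vertex \<Rightarrow> real" where
  "box C m 0 H x = of_bool (x \<in> C m)"
| "box C m (Suc n) H x = of_bool (x \<in> C m) * (\<Sum>y\<in>nbr x. exit_prob 0 H x y * box C (Suc m) n (upd H x y) y)"

lemma box_above_at: "m + n = N \<Longrightarrow> box (\<lambda>i. if i = N then {x. k \<le> length x} else UNIV) m n H x = above_at k n H x"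
  by (induction n arbitrary: m H x) (auto simp: above_at_def reached_def)

text \<open>The probability that the root is not visited in the next \<open>n\<close> steps.\<close>
definition no_return :: "nat \<Rightarrow> exits \<Rightarrow> vertex \<Rightarrow> real" where
  "no_return = payoff 0 1 {[]} {} (\<lambda>_. 1)"

lemma no_return_nonneg: "no_return n H x \<ge> 0"
  unfolding no_return_def by (rule payoff_nonneg) auto

lemma no_return_Suc_le: "no_return (Suc n) H x \<le> no_return n H x"
proof (induction n arbitrary: H x)
  case 0
  show ?case using payoff_le_1[of 0 1 "\<lambda>_. 1" "{[]}" "{}" "Suc 0" H x] by (simp add: no_return_def)
next
  case (Suc n)
  have "(\<Sum>y\<in>nbr x - {[]}. exit_prob 0 H x y * no_return (Suc n) (upd H x y) y)
     \<le> (\<Sum>y\<in>nbr x - {[]}. exit_prob 0 H x y * no_return n (upd H x y) y)"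
    by (intro sum_mono mult_left_mono Suc exit_prob_nonneg) simp
  then show ?case by (simp add: no_return_def)
qed

lemma no_return_Suc_survival: "no_return (Suc n) no_exits [] = survival 1 n no_exits []"
  unfolding no_return_def survival_def by (rule payoff_after_first_step) auto

lemma box_no_return:
  assumes "j \<le> m"
  shows "box (\<lambda>i. if i \<le> j then UNIV else - {[]}) m n H x \<le> no_return n H x"
  using assms
proof (induction n arbitrary: m H x)
  case 0
  then show ?case by (simp add: no_return_def)
next
  case (Suc n)
  let ?C = "\<lambda>i. if i \<le> j then UNIV else - {[]::vertex}"
  have z: "box ?C (Suc m) n H' [] = 0" for H'
    using Suc.prems by (cases n) auto
  have "(\<Sum>y\<in>nbr x. exit_prob 0 H x y * box ?C (Suc m) n (upd H x y) y)
      = (\<Sum>y\<in>nbr x - {[]}. exit_prob 0 H x y * box ?C (Suc m) n (upd H x y) y)"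
    by (intro sum.mono_neutral_right) (auto simp: z)
  also have "\<dots> \<le> (\<Sum>y\<in>nbr x - {[]}. exit_prob 0 H x y * no_return n (upd H x y) y)"
    using Suc.prems by (intro sum_mono mult_left_mono Suc.IH exit_prob_nonneg) auto
  also have "\<dots> = no_return (Suc n) H x" by (simp add: no_return_def)
  finally show ?case using no_return_nonneg[of "Suc n" H x] by auto
qed

text \<open>If the root is not visited after time \<open>j\<close>, decompose at the last visit to the root.  There are
  \<open>j - m = d\<close> possible times for it after \<open>m\<close>, and exchangeability bounds each of them by the probability
  that a walk started at the root does not return within \<open>K\<close> steps.\<close>
lemma box_last_return:
  assumes "m + d = j"
  shows "box (\<lambda>i. if i \<le> j then UNIV else - {[]}) m (d + K) H x
    \<le> no_return K H x + real d * no_return K H []"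
  using assms
proof (induction d arbitrary: m H x)
  case 0
  then show ?case using box_no_return[of j m K H x] by simp
next
  case (Suc d)
  let ?C = "\<lambda>i. if i \<le> j then UNIV else - {[]::vertex}"
  have "box ?C m (Suc d + K) H x = (\<Sum>y\<in>nbr x. exit_prob 0 H x y * box ?C (Suc m) (d + K) (upd H x y) y)"
    using Suc.prems by simp
  also have "\<dots> \<le> (\<Sum>y\<in>nbr x. exit_prob 0 H x y *
     ((if y \<in> {[]} then 0 else no_return K (upd H x y) y) + real (Suc d) * no_return K (upd H x y) []))"
  proof (intro sum_mono mult_left_mono exit_prob_nonneg)
    fix y
    have "box ?C (Suc m) (d + K) (upd H x y) y \<le> no_return K (upd H x y) y + real d * no_return K (upd H x y) []"
      using Suc.prems by (intro Suc.IH) simp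
    then show "box ?C (Suc m) (d + K) (upd H x y) y \<le>
      (if y \<in> {[]} then 0 else no_return K (upd H x y) y) + real (Suc d) * no_return K (upd H x y) []"
      using no_return_nonneg[of K "upd H x y" "[]"] by (auto simp: algebra_simps)
  qed simp
  also have "\<dots> = (\<Sum>y\<in>nbr x. if y \<in> {[]} then 0 else exit_prob 0 H x y * no_return K (upd H x y) y)
      + real (Suc d) * (\<Sum>y\<in>nbr x. exit_prob 0 H x y * no_return K (upd H x y) [])"
    unfolding sum_distrib_left sum.distrib[symmetric]
    by (intro sum.cong) (auto simp: algebra_simps)
  also have "(\<Sum>y\<in>nbr x. if y \<in> {[]} then 0 else exit_prob 0 H x y * no_return K (upd H x y) y) = no_return (Suc K) H x"
    unfolding no_return_def by (simp add: sum_Diff_if)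
  also have "(\<Sum>y\<in>nbr x. exit_prob 0 H x y * no_return K (upd H x y) []) = no_return K H []"
    unfolding no_return_def by (rule payoff_mixing)
  finally show ?case using no_return_Suc_le[of K H x] by linarith
qed

end

lemma (in prob_space) prob_partition:
  assumes [measurable]: "Measurable.pred M S" "Y \<in> measurable M (count_space UNIV)" and "finite N"
  shows "prob {\<omega> \<in> space M. S \<omega>} = prob {\<omega> \<in> space M. S \<omega> \<and> Y \<omega> \<notin> N}
    + (\<Sum>y\<in>N. prob {\<omega> \<in> space M. S \<omega> \<and> Y \<omega> = y})"
proof -
  have [measurable]: "Measurable.pred M (\<lambda>\<omega>. Y \<omega> \<in> N)"
    by (rule measurable_compose[OF assms(2)]) simp
  have m[measurable]: "{\<omega> \<in> space M. S \<omega> \<and> Y \<omega> = y} \<in> events" "{\<omega> \<in> space M. S \<omega> \<and> Y \<omega> \<notin> N} \<in> events" for y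
    by measurable
  have "prob (\<Union>y\<in>N. {\<omega> \<in> space M. S \<omega> \<and> Y \<omega> = y}) = (\<Sum>y\<in>N. prob {\<omega> \<in> space M. S \<omega> \<and> Y \<omega> = y})"
    using assms by (intro finite_measure_finite_Union) (auto simp: disjoint_family_on_def)
  moreover have "{\<omega> \<in> space M. S \<omega>} = {\<omega> \<in> space M. S \<omega> \<and> Y \<omega> \<notin> N} \<union> (\<Union>y\<in>N. {\<omega> \<in> space M. S \<omega> \<and> Y \<omega> = y})"
    by auto
  moreover have "prob ({\<omega> \<in> space M. S \<omega> \<and> Y \<omega> \<notin> N} \<union> (\<Union>y\<in>N. {\<omega> \<in> space M. S \<omega> \<and> Y \<omega> = y}))
    = prob {\<omega> \<in> space M. S \<omega> \<and> Y \<omega> \<notin> N} + prob (\<Union>y\<in>N. {\<omega> \<in> space M. S \<omega> \<and> Y \<omega> = y})"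
    using assms(3) by (intro finite_measure_Union sets.finite_UN) auto
  ultimately show ?thesis by simp
qed

locale lrrw = reinforced_tree b for b +
  fixes M :: "'a measure" and X :: "nat \<Rightarrow> 'a \<Rightarrow> vertex"
  assumes walk: "reinforced_walk b 2 M X"
begin

sublocale prob_space M
  using walk by (simp add: reinforced_walk_def)

lemma X_measurable [measurable]: "X n \<in> measurable M (count_space UNIV)"
  using walk by (simp add: reinforced_walk_def)

lemma X_in_measurable [measurable]: "Measurable.pred M (\<lambda>\<omega>. X n \<omega> \<in> A)"
  by (rule measurable_compose[OF X_measurable]) simp

lemma height_measurable [measurable]: "(\<lambda>\<omega>. height (X n \<omega>)) \<in> measurable M (count_space UNIV)"
  by (rule measurable_compose[OF X_measurable]) simp

definition follows :: "(nat \<Rightarrow> vertex) \<Rightarrow> nat \<Rightarrow> real" where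
  "follows x n = prob {\<omega> \<in> space M. \<forall>i\<le>n. X i \<omega> = x i}"

lemma follows_nonneg: "follows x n \<ge> 0"
  by (simp add: follows_def)

lemma follows_Suc: "follows x (Suc n) = follows x n * step_prob b 2 x n (x (Suc n))"
proof -
  have e: "{\<omega> \<in> space M. X (Suc n) \<omega> = x (Suc n) \<and> (\<forall>i\<le>n. X i \<omega> = x i)} = {\<omega> \<in> space M. \<forall>i\<le>Suc n. X i \<omega> = x i}"
    by (auto simp: le_Suc_eq)
  show ?thesis
  proof (cases "follows x n = 0")
    case True
    have "follows x (Suc n) \<le> follows x n"
      unfolding follows_def by (intro finite_measure_mono) auto
    then show ?thesis using True follows_nonneg[of x "Suc n"] by simp
  next
    case False
    then have "follows x n > 0" using follows_nonneg[of x n] by simp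
    then have "cond_prob M (\<lambda>\<omega>. X (Suc n) \<omega> = x (Suc n)) (\<lambda>\<omega>. \<forall>i\<le>n. X i \<omega> = x i) = step_prob b 2 x n (x (Suc n))"
      using walk by (simp add: reinforced_walk_def follows_def)
    then have "follows x (Suc n) / follows x n = step_prob b 2 x n (x (Suc n))"
      by (simp add: cond_prob_def e follows_def)
    then show ?thesis using False by (simp add: field_simps)
  qed
qed

lemma AE_start: "AE \<omega> in M. X 0 \<omega> = []"
  using walk by (simp add: reinforced_walk_def)

lemma tree_walk_if_follows: "follows x n > 0 \<Longrightarrow> tree_walk x n"
proof (induction n)
  case 0
  have "x 0 = []"
  proof (rule ccontr)
    assume "x 0 \<noteq> []"
    then have "AE \<omega> in M. \<not> (\<forall>i\<le>0. X i \<omega> = x i)" using AE_start by auto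
    then have "follows x 0 = 0" unfolding follows_def by (subst prob_eq_0) auto
    then show False using 0 by simp
  qed
  then show ?case by (simp add: tree_walk_def)
next
  case (Suc n)
  then have ne: "follows x n * step_prob b 2 x n (x (Suc n)) \<noteq> 0" by (metis follows_Suc less_irrefl)
  then have w: "tree_walk x n" using Suc.IH follows_nonneg[of x n] by fastforce
  then have "x (Suc n) \<in> nbr (x n)" using ne step_prob_eq[OF w, of "x (Suc n)"] by (auto split: if_splits)
  then show ?case using w by (auto simp: tree_walk_def less_Suc_eq)
qed

text \<open>Moves to non-neighbours need no separate treatment: the exit probabilities of the neighbours
  sum to 1, so that nothing is left for other moves.\<close>
lemma prob_box_from:
  "prob {\<omega> \<in> space M. (\<forall>i\<le>m. X i \<omega> = x i) \<and> (\<forall>i\<in>{m..m+n}. X i \<omega> \<in> C i)}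
    = follows x m * box C m n (exits_upto x m) (x m)"
proof (induction n arbitrary: m x)
  case 0
  have "{\<omega> \<in> space M. (\<forall>i\<le>m. X i \<omega> = x i) \<and> (\<forall>i\<in>{m..m+0}. X i \<omega> \<in> C i)} =
    (if x m \<in> C m then {\<omega> \<in> space M. \<forall>i\<le>m. X i \<omega> = x i} else {})"
    by auto
  then show ?case by (simp add: follows_def)
next
  case (Suc n)
  let ?S = "\<lambda>\<omega>. (\<forall>i\<le>m. X i \<omega> = x i) \<and> (\<forall>i\<in>{m..m+Suc n}. X i \<omega> \<in> C i)"
  let ?F = "\<lambda>\<omega>. \<forall>i\<le>m. X i \<omega> = x i"
  have le: "prob {\<omega> \<in> space M. ?S \<omega>} \<le> follows x m"
    unfolding follows_def by (intro finite_measure_mono) auto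
  consider "follows x m = 0" | "x m \<notin> C m" | "follows x m > 0" "x m \<in> C m"
    using follows_nonneg[of x m] by fastforce
  then show ?case
  proof cases
    case 1
    then show ?thesis using le by (simp add: measure_le_0_iff)
  next
    case 2
    then have "\<not> ?S \<omega>" for \<omega> by (auto intro!: exI[of _ m] bexI[of _ m])
    then have e: "{\<omega> \<in> space M. ?S \<omega>} = {}" by blast
    show ?thesis unfolding e using 2 by simp
  next
    case 3
    have w: "tree_walk x m" using 3 by (rule_tac tree_walk_if_follows)
    let ?x = "\<lambda>y. x(Suc m := y)"
    have ex: "exits_upto (?x y) m = exits_upto x m" for y
      by (rule exits_upto_cong) simp
    have w': "tree_walk (?x y) m" for y
      using w by (auto simp: tree_walk_def)
    have fx: "follows (?x y) m = follows x m" for y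
      unfolding follows_def by (intro arg_cong[where f = prob] Collect_cong) auto
    have fy: "follows (?x y) (Suc m) = follows x m * exit_prob 0 (exits_upto x m) (x m) y" if "y \<in> nbr (x m)" for y
      using that by (simp add: follows_Suc fx step_prob_eq[OF w'] ex)
    have F: "follows x m = prob {\<omega> \<in> space M. ?F \<omega> \<and> X (Suc m) \<omega> \<notin> nbr (x m)}
      + (\<Sum>y\<in>nbr (x m). prob {\<omega> \<in> space M. ?F \<omega> \<and> X (Suc m) \<omega> = y})"
      unfolding follows_def by (rule prob_partition) auto
    have "prob {\<omega> \<in> space M. ?F \<omega> \<and> X (Suc m) \<omega> = y} = follows (?x y) (Suc m)" for y
      unfolding follows_def by (intro arg_cong[where f = prob] Collect_cong) (auto simp: le_Suc_eq)
    then have "(\<Sum>y\<in>nbr (x m). prob {\<omega> \<in> space M. ?F \<omega> \<and> X (Suc m) \<omega> = y}) = follows x m"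
      by (simp add: fy sum_distrib_left[symmetric] sum_exit_prob)
    then have "prob {\<omega> \<in> space M. ?F \<omega> \<and> X (Suc m) \<omega> \<notin> nbr (x m)} = 0" using F by simp
    moreover have "prob {\<omega> \<in> space M. ?S \<omega> \<and> X (Suc m) \<omega> \<notin> nbr (x m)}
        \<le> prob {\<omega> \<in> space M. ?F \<omega> \<and> X (Suc m) \<omega> \<notin> nbr (x m)}"
      by (intro finite_measure_mono) auto
    ultimately have R: "prob {\<omega> \<in> space M. ?S \<omega> \<and> X (Suc m) \<omega> \<notin> nbr (x m)} = 0"
      using measure_nonneg[of M "{\<omega> \<in> space M. ?S \<omega> \<and> X (Suc m) \<omega> \<notin> nbr (x m)}"] by linarith
    have E: "prob {\<omega> \<in> space M. ?S \<omega> \<and> X (Suc m) \<omega> = y} =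
      prob {\<omega> \<in> space M. (\<forall>i\<le>Suc m. X i \<omega> = ?x y i) \<and> (\<forall>i\<in>{Suc m..Suc m+n}. X i \<omega> \<in> C i)}" for y
    proof (intro arg_cong[where f = prob] Collect_cong)
      fix \<omega>
      have "{m..m + Suc n} = insert m {Suc m..Suc m + n}" by auto
      then show "(\<omega> \<in> space M \<and> ?S \<omega> \<and> X (Suc m) \<omega> = y) \<longleftrightarrow>
        (\<omega> \<in> space M \<and> (\<forall>i\<le>Suc m. X i \<omega> = ?x y i) \<and> (\<forall>i\<in>{Suc m..Suc m+n}. X i \<omega> \<in> C i))"
        using 3 by (auto simp: le_Suc_eq)
    qed
    have "prob {\<omega> \<in> space M. ?S \<omega>} = prob {\<omega> \<in> space M. ?S \<omega> \<and> X (Suc m) \<omega> \<notin> nbr (x m)}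
      + (\<Sum>y\<in>nbr (x m). prob {\<omega> \<in> space M. ?S \<omega> \<and> X (Suc m) \<omega> = y})"
      by (rule prob_partition) auto
    also have "(\<Sum>y\<in>nbr (x m). prob {\<omega> \<in> space M. ?S \<omega> \<and> X (Suc m) \<omega> = y})
      = (\<Sum>y\<in>nbr (x m). follows x m * exit_prob 0 (exits_upto x m) (x m) y * box C (Suc m) n (upd (exits_upto x m) (x m) y) y)"
    proof (rule sum.cong)
      fix y assume y: "y \<in> nbr (x m)"
      have "prob {\<omega> \<in> space M. ?S \<omega> \<and> X (Suc m) \<omega> = y}
        = follows (?x y) (Suc m) * box C (Suc m) n (exits_upto (?x y) (Suc m)) (?x y (Suc m))"
        unfolding E by (rule Suc.IH)
      then show "prob {\<omega> \<in> space M. ?S \<omega> \<and> X (Suc m) \<omega> = y}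
        = follows x m * exit_prob 0 (exits_upto x m) (x m) y * box C (Suc m) n (upd (exits_upto x m) (x m) y) y"
        unfolding fy[OF y] exits_upto_Suc ex by simp
    qed simp
    finally show ?thesis using 3 R by (simp add: sum_distrib_left mult_ac)
  qed
qed

lemma prob_box: "prob {\<omega> \<in> space M. \<forall>i\<le>n. X i \<omega> \<in> C i} = box C 0 n no_exits []"
proof -
  let ?x = "\<lambda>_::nat. [] :: vertex"
  have "follows ?x 0 = 1"
    unfolding follows_def using AE_start by (subst prob_eq_1) auto
  moreover have "prob {\<omega> \<in> space M. \<forall>i\<le>n. X i \<omega> \<in> C i} =
    prob {\<omega> \<in> space M. (\<forall>i\<le>0. X i \<omega> = ?x i) \<and> (\<forall>i\<in>{0..0+n}. X i \<omega> \<in> C i)}"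
    using AE_start by (intro finite_measure_eq_AE) auto
  ultimately show ?thesis using prob_box_from[of 0 ?x n C] by (simp add: exits_upto_0)
qed

lemma prob_above_at: "prob {\<omega> \<in> space M. k \<le> height (X n \<omega>)} = above_at k n no_exits []"
proof -
  have "{\<omega> \<in> space M. k \<le> height (X n \<omega>)} =
    {\<omega> \<in> space M. \<forall>i\<le>n. X i \<omega> \<in> (if i = n then {x. k \<le> length x} else UNIV)}"
    by (auto simp: height_def)
  then show ?thesis by (simp only: prob_box box_above_at[OF add_0])
qed

text \<open>As the speed is positive, for some \<open>j\<close> there is a positive probability \<open>\<pi>\<close> of no visit to the root
  after time \<open>j\<close>.  By \<open>box_last_return\<close> it is at most \<open>1 + j\<close> times the probability that the killed copy
  survives for \<open>m\<close> steps, whatever \<open>m\<close> is.\<close>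
lemma survival_bounded_below:
  assumes lim: "AE \<omega> in M. (\<lambda>n. real (height (X n \<omega>)) / real n) \<longlonglongrightarrow> T" and T: "T > 0"
  obtains q where "q > 0" "\<And>m. q \<le> survival 1 m no_exits []"
proof -
  have ev: "AE \<omega> in M. \<exists>j. \<forall>l>j. X l \<omega> \<noteq> []"
    using lim
  proof eventually_elim
    case (elim \<omega>)
    from order_tendstoD(1)[OF elim T] obtain j where j: "\<And>n. n \<ge> j \<Longrightarrow> 0 < real (height (X n \<omega>)) / real n"
      by (auto simp: eventually_sequentially)
    have "X l \<omega> \<noteq> []" if "l > j" for l
      using j[of l] that by (auto simp: height_def)
    then show ?case by blast
  qed
  have "\<exists>j. prob {\<omega> \<in> space M. \<forall>l>j. X l \<omega> \<noteq> []} > 0"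
  proof (rule ccontr)
    assume "\<not> ?thesis"
    then have z: "prob {\<omega> \<in> space M. \<forall>l>j. X l \<omega> \<noteq> []} = 0" for j
      unfolding not_ex not_less measure_le_0_iff by blast
    have "AE \<omega> in M. \<not> (\<forall>l>j. X l \<omega> \<noteq> [])" for j
      using z[of j] by (subst (asm) prob_eq_0) auto
    then have "AE \<omega> in M. \<forall>j. \<not> (\<forall>l>j. X l \<omega> \<noteq> [])" by (simp add: AE_all_countable)
    with ev have "AE \<omega> in M. False" by eventually_elim blast
    then show False by simp
  qed
  then obtain j where j: "prob {\<omega> \<in> space M. \<forall>l>j. X l \<omega> \<noteq> []} > 0" (is "?\<pi> > 0") ..
  let ?C = "\<lambda>i. if i \<le> j then UNIV else - {[]::vertex}"
  have "?\<pi> \<le> (1 + real j) * survival 1 m no_exits []" for m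
  proof -
    have "?\<pi> \<le> prob {\<omega> \<in> space M. \<forall>i\<le>j + Suc m. X i \<omega> \<in> ?C i}"
      by (intro finite_measure_mono) auto
    also have "\<dots> \<le> no_return (Suc m) no_exits [] + real j * no_return (Suc m) no_exits []"
      unfolding prob_box by (rule box_last_return) simp
    finally show ?thesis by (simp add: no_return_Suc_survival algebra_simps)
  qed
  then have "?\<pi> / (1 + real j) \<le> survival 1 m no_exits []" for m
    by (simp add: divide_le_eq mult.commute)
  then show ?thesis using j that[of "?\<pi> / (1 + real j)"] by simp
qed

lemma prob_fast_tendsto_0:
  assumes lim: "AE \<omega> in M. (\<lambda>n. real (height (X n \<omega>)) / real n) \<longlonglongrightarrow> T" and T: "T < c"
  shows "(\<lambda>n. prob {\<omega> \<in> space M. c * real n \<le> real (height (X n \<omega>))}) \<longlonglongrightarrow> 0"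
proof -
  let ?A = "\<lambda>n. {\<omega> \<in> space M. c * real n \<le> real (height (X n \<omega>))}"
  have "(\<lambda>n. \<integral>\<omega>. indicator (?A n) \<omega> \<partial>M) \<longlonglongrightarrow> (\<integral>\<omega>. (0::real) \<partial>M)"
  proof (rule integral_dominated_convergence[where w = "\<lambda>_. 1"])
    show "AE \<omega> in M. (\<lambda>n. indicator (?A n) \<omega> :: real) \<longlonglongrightarrow> 0"
      using lim
    proof eventually_elim
      case (elim \<omega>)
      have "eventually (\<lambda>n. (indicator (?A n) \<omega> :: real) = 0) sequentially"
        using order_tendstoD(2)[OF elim T] eventually_gt_at_top[of 0]
        by eventually_elim (auto simp: indicator_def field_simps)
      then show ?case by (rule tendsto_eventually)
    qed
  qed (auto simp: indicator_def)
  then show ?thesis by simp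
qed

end

section \<open>Exponential decay and the rate\<close>

lemma fekete:
  fixes x :: "nat \<Rightarrow> real"
  assumes sub: "\<And>n m. n \<ge> 1 \<Longrightarrow> m \<ge> 1 \<Longrightarrow> x (n + m) \<le> x n + x m"
    and nonneg: "\<And>n. n \<ge> 1 \<Longrightarrow> 0 \<le> x n"
  obtains L where "(\<lambda>n. x n / real n) \<longlonglongrightarrow> L"
proof -
  define L where "L = (INF n\<in>{1..}. x n / real n)"
  have bdd: "bdd_below ((\<lambda>n. x n / real n) ` {1..})"
    using nonneg by (intro bdd_belowI2[of _ 0]) auto
  have lower: "L \<le> x n / real n" if "n \<ge> 1" for n
    unfolding L_def using that by (intro cINF_lower[OF bdd]) auto
  have mult: "x (j * N + r) \<le> real j * x N + x r" if "N \<ge> 1" "r \<ge> 1" for j N r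
  proof (induction j)
    case (Suc j)
    have "x (N + (j * N + r)) \<le> x N + x (j * N + r)" using that by (intro sub) auto
    then show ?case using Suc by (simp add: algebra_simps)
  qed simp
  have "(\<lambda>n. x n / real n) \<longlonglongrightarrow> L"
  proof (rule LIMSEQ_I)
    fix e :: real assume e: "e > 0"
    have "\<exists>N\<in>{1..}. x N / real N < L + e / 2"
    proof (rule ccontr)
      assume "\<not> ?thesis"
      then have "L + e / 2 \<le> (INF n\<in>{1..}. x n / real n)"
        by (intro cINF_greatest) (auto simp: not_less)
      then show False using e unfolding L_def[symmetric] by simp
    qed
    then obtain N where N: "N \<ge> 1" "x N / real N < L + e / 2" by auto
    define B where "B = (\<Sum>r\<in>{1..N}. x r)"
    have B: "x r \<le> B" if "1 \<le> r" "r \<le> N" for r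
      unfolding B_def using that nonneg by (intro member_le_sum) auto
    obtain n0 :: nat where n0: "2 * B / e < real n0" using reals_Archimedean2 by blast
    show "\<exists>no. \<forall>n\<ge>no. norm (x n / real n - L) < e"
    proof (intro exI[of _ "max 1 n0"] allI impI)
      fix n assume n: "max 1 n0 \<le> n"
      then have n1: "n \<ge> 1" by simp
      define j where "j = (n - 1) div N"
      define r where "r = Suc ((n - 1) mod N)"
      have nj: "n = j * N + r" using n1 unfolding j_def r_def
        using div_mult_mod_eq[of "n - 1" N] by linarith
      have r: "1 \<le> r" "r \<le> N" unfolding r_def using N(1) by (auto simp: Suc_le_eq)
      have "x n \<le> real j * x N + B" using mult[OF N(1) r(1), of j] B[OF r] nj by simp
      also have "real j * x N = real (j * N) * (x N / real N)" using N by simp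
      also have "\<dots> \<le> real n * (x N / real N)"
        using nj nonneg[OF N(1)] by (intro mult_right_mono) auto
      also have "\<dots> \<le> real n * (L + e / 2)" using N by (intro mult_left_mono) auto
      finally have "x n / real n \<le> L + e / 2 + B / real n"
        using n1 by (simp add: field_simps)
      moreover have "B / real n < e / 2"
      proof -
        have "2 * B / e < real n" using n0 n by linarith
        then show ?thesis using e n1 by (simp add: field_simps)
      qed
      ultimately show "norm (x n / real n - L) < e" using lower[OF n1] e unfolding real_norm_def by linarith
    qed
  qed
  then show ?thesis using that by blast
qed

context reinforced_tree
begin

lemma above_at_unreachable: "length x + n < k \<Longrightarrow> above_at k n H x = 0"
proof (induction n arbitrary: H x)
  case (Suc n)
  have "above_at k n (upd H x y) y = 0" if "y \<in> nbr x" for y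
    using Suc.prems length_nbr[OF that] by (intro Suc.IH) simp
  then show ?case by (simp add: above_at_def)
qed (simp add: above_at_def reached_def)

lemma hit_step_pos: "hit 1 1 1 1 no_exits [] > 0"
proof -
  have "hit 1 1 1 1 no_exits [] = (\<Sum>y\<in>nbr []. exit_prob 1 no_exits [] y * hit 1 1 1 0 (upd no_exits [] y) y)"
    using hit_Suc[of "[]" 1 1 1 0 no_exits] by simp
  also have "\<dots> = (\<Sum>y\<in>nbr []. exit_prob 1 no_exits [] y)"
    by (intro sum.cong) (auto simp: nbr_def)
  also have "\<dots> > 0" by (intro sum_pos) (auto simp: nbr_nonempty exit_prob_pos)
  finally show ?thesis .
qed

lemma hit_pos:
  assumes "l \<le> m"
  shows "hit 1 1 l m no_exits [] > 0"
proof -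
  have "hit 1 1 l l no_exits [] > 0"
  proof (induction l)
    case (Suc l)
    have "0 < hit 1 1 1 1 no_exits [] * hit 1 1 l l no_exits []"
      using Suc hit_step_pos by simp
    also have "\<dots> \<le> hit 1 1 (1 + l) (1 + l) no_exits []"
      by (rule hit_supermult) auto
    finally show ?case by simp
  qed simp
  also have "hit 1 1 l l no_exits [] \<le> hit 1 1 l m no_exits []"
    by (rule hit_mono_time) (use assms in auto)
  finally show ?thesis .
qed

text \<open>The arguments are shifted by 1 because the killed copy starts at height 1 at time 1.  The
  sequence is supermultiplicative only up to the constant \<open>c\<close>, the price of the one step up that
  makes good for the second shift; \<open>\<lceil>\<dots>\<rceil>\<close> is subadditive, which goes in the right direction.\<close>
lemma killed_passage_rate:
  assumes a: "0 < a" "a \<le> 1"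
  obtains L where "(\<lambda>n. - ln (hit 1 1 (nat \<lceil>a * real n\<rceil> - 1) (n - 1) no_exits []) / real n) \<longlonglongrightarrow> L"
proof -
  define K where "K n = nat \<lceil>a * real n\<rceil>" for n
  define Q where "Q n k = hit 1 1 k n no_exits []" for n k
  define c where "c = Q 1 1"
  have c: "0 < c" "c \<le> 1" unfolding c_def Q_def using hit_step_pos by (auto intro!: hit_le_1)
  have K1: "1 \<le> K n" if "n \<ge> 1" for n
    using that a by (simp add: K_def Suc_le_eq)
  have Kn: "K n \<le> n" for n
  proof -
    have "a * real n \<le> 1 * real n" using a by (intro mult_right_mono) auto
    then show ?thesis by (simp add: K_def ceiling_le_iff nat_le_iff)
  qed
  have Kadd: "K (n + m) \<le> K n + K m" for n m
  proof -
    have "\<lceil>a * real (n + m)\<rceil> \<le> \<lceil>a * real n\<rceil> + \<lceil>a * real m\<rceil>"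
      using ceiling_add_le[of "a * real n" "a * real m"] by (simp add: distrib_left)
    then have "K (n + m) \<le> nat (\<lceil>a * real n\<rceil> + \<lceil>a * real m\<rceil>)"
      unfolding K_def by (rule nat_mono)
    also have "\<dots> = K n + K m"
      unfolding K_def using a by (intro nat_add_distrib) (simp_all add: less_le_trans[of "-1" 0])
    finally show ?thesis .
  qed
  have Qpos: "0 < Q (n - 1) (K n - 1)" for n
    unfolding Q_def using Kn[of n] by (intro hit_pos diff_le_mono)
  define x where "x n = - ln (c * Q (n - 1) (K n - 1))" for n
  have "x (n + m) \<le> x n + x m" if nm: "n \<ge> 1" "m \<ge> 1" for n m
  proof -
    have "1 + (m - 1) = m" "1 + (K m - 1) = K m" using nm K1[OF nm(2)] by simp_all
    moreover have "c * Q (m - 1) (K m - 1) \<le> Q (1 + (m - 1)) (1 + (K m - 1))"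
      unfolding c_def Q_def by (rule hit_supermult) auto
    ultimately have step: "c * Q (m - 1) (K m - 1) \<le> Q m (K m)" by simp
    have "c * Q (n - 1) (K n - 1) * (c * Q (m - 1) (K m - 1)) \<le> c * Q (n - 1) (K n - 1) * Q m (K m)"
      using c Qpos[of n] by (intro mult_left_mono step mult_nonneg_nonneg) auto
    also have "\<dots> = c * (Q (n - 1) (K n - 1) * Q m (K m))" by simp
    also have "\<dots> \<le> c * Q (n - 1 + m) (K n - 1 + K m)"
      using c unfolding Q_def by (intro mult_left_mono hit_supermult) auto
    also have "\<dots> \<le> c * Q (n - 1 + m) (K (n + m) - 1)"
      using c Kadd[of n m] K1[of n] nm unfolding Q_def by (intro mult_left_mono hit_antimono_level) auto
    also have "n - 1 + m = n + m - 1" using nm by simp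
    finally have "ln (c * Q (n - 1) (K n - 1) * (c * Q (m - 1) (K m - 1))) \<le> ln (c * Q (n + m - 1) (K (n + m) - 1))"
      using c Qpos by (intro ln_mono) auto
    then show ?thesis
      using c Qpos[of n] Qpos[of m] unfolding x_def by (subst (asm) ln_mult) auto
  qed
  moreover have "0 \<le> x n" for n
  proof -
    have "c * Q (n - 1) (K n - 1) \<le> 1 * 1"
      using c Qpos[of n] unfolding Q_def by (intro mult_mono hit_le_1) auto
    then show ?thesis using c Qpos[of n] by (simp add: x_def)
  qed
  ultimately obtain L where L: "(\<lambda>n. x n / real n) \<longlonglongrightarrow> L"
    using fekete[of x] by blast
  have "(\<lambda>n. x n / real n + ln c / real n) \<longlonglongrightarrow> L + 0"
    by (intro tendsto_add L lim_const_over_n)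
  moreover have "x n / real n + ln c / real n = - ln (Q (n - 1) (K n - 1)) / real n" for n
    using c Qpos[of n] by (simp add: x_def ln_mult add_divide_distrib[symmetric])
  ultimately show ?thesis using that[of L] by (simp add: Q_def K_def)
qed

text \<open>If it becomes unlikely to reach height \<open>k\<close> within time \<open>t * k\<close>, then it is exponentially unlikely to
  climb at any speed \<open>a\<close> greater than \<open>1 / t\<close>.  With \<open>s = exp (- \<mu> / k)\<close> one has
  \<open>\<phi> k \<le> P(\<tau> k \<le> t * k) + exp (- \<mu> * t)\<close>, whereas speed \<open>a\<close> requires \<open>\<phi> k\<close> to be about \<open>exp (- \<mu> / a)\<close>
  per block of height \<open>k\<close>.  First \<open>\<mu>\<close> is chosen so large that the second term, divided by \<open>q\<close>, is a
  quarter of this, then \<open>k\<close> so large that the first term is another quarter; each of the \<open>a * n / k\<close>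
  blocks then contributes a factor \<open>1/2\<close>.\<close>
lemma passage_exp_bound:
  assumes a: "0 < a" "1 / a < t" and q: "0 < q" "\<And>m. q \<le> survival 1 m no_exits []"
    and lim: "(\<lambda>k. hit 0 1 k (nat \<lfloor>t * real k\<rfloor>) no_exits []) \<longlonglongrightarrow> 0"
  obtains C \<delta> where "C > 0" "\<delta> > 0"
    "\<And>n. hit 0 1 (nat \<lceil>a * real n\<rceil>) n no_exits [] \<le> C * exp (- \<delta> * real n)"
proof -
  define \<mu> where "\<mu> = ln (4 / q) / (t - 1 / a)"
  have q1: "q \<le> 1" using q(2)[of 0] by (simp add: survival_0)
  have \<mu>: "\<mu> \<ge> 0" unfolding \<mu>_def using q q1 a by (intro divide_nonneg_pos ln_ge_zero) auto
  have "- \<mu> * t = - \<mu> / a - ln (4 / q)"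
  proof -
    have "\<mu> * (t - 1 / a) = ln (4 / q)" using a by (simp add: \<mu>_def)
    then show ?thesis by (simp add: algebra_simps)
  qed
  moreover have "exp (- ln (4 / q)) = q / 4"
    by (subst exp_minus, subst exp_ln) (use q in auto)
  ultimately have e: "exp (- \<mu> * t) = exp (- \<mu> / a) * (q / 4)"
    by (metis diff_conv_add_uminus exp_add)
  have "eventually (\<lambda>k. hit 0 1 k (nat \<lfloor>t * real k\<rfloor>) no_exits [] < exp (- \<mu> / a) * (q / 4) \<and> k > 0) sequentially"
    using q by (intro eventually_conj order_tendstoD(2)[OF lim] eventually_gt_at_top) simp
  then obtain k where k: "k > 0" "hit 0 1 k (nat \<lfloor>t * real k\<rfloor>) no_exits [] < exp (- \<mu> / a) * (q / 4)"
    by (auto simp: eventually_sequentially)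
  define s where "s = exp (- \<mu> / real k)"
  have s: "0 < s" "s \<le> 1" using \<mu> by (auto simp: s_def)
  have base: "hit 0 s k n no_exits [] \<le> q * (exp (- \<mu> / a) / 2)" for n
  proof -
    let ?m = "nat \<lfloor>t * real k\<rfloor>"
    have "t * real k \<le> real (Suc ?m)" by linarith
    then have "\<mu> * t \<le> \<mu> * (real (Suc ?m) / real k)"
      using \<mu> k by (intro mult_left_mono) (auto simp: field_simps)
    then have "s ^ Suc ?m \<le> exp (- \<mu> * t)"
      unfolding s_def exp_of_nat_mult[symmetric] by (simp add: mult.commute)
    with hit_discount_le[OF less_imp_le[OF s(1)] s(2), of k n no_exits "[]" ?m] k(2) e
    have "hit 0 s k n no_exits [] \<le> exp (- \<mu> / a) * (q / 4) + exp (- \<mu> / a) * (q / 4)"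
      by linarith
    also have "\<dots> = q * (exp (- \<mu> / a) / 2)" by (simp add: field_simps)
    finally show ?thesis .
  qed
  have iter: "hit 0 s (j * k) n no_exits [] \<le> (exp (- \<mu> / a) / 2) ^ j" for j n
  proof (induction j)
    case (Suc j)
    have "q * hit 0 s (k + j * k) n no_exits [] \<le> hit 0 s k n no_exits [] * hit 0 s (j * k) n no_exits []"
      using k s q by (intro hit_submult) auto
    also have "\<dots> \<le> (q * (exp (- \<mu> / a) / 2)) * (exp (- \<mu> / a) / 2) ^ j"
      using s q by (intro mult_mono base Suc hit_nonneg) auto
    finally show ?case using q by (simp add: mult.assoc)
  qed simp
  define C where "C = 2 * exp (\<mu> / a)"
  define \<delta> where "\<delta> = ln 2 * a / real k"
  have "hit 0 1 (nat \<lceil>a * real n\<rceil>) n no_exits [] \<le> C * exp (- \<delta> * real n)" for n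
  proof -
    define j where "j = nat \<lfloor>a * real n / real k\<rfloor>"
    have "0 \<le> a * real n / real k" using a k by simp
    then have j: "real j \<le> a * real n / real k" "a * real n / real k < real j + 1"
      unfolding j_def by linarith+
    have "real (j * k) \<le> a * real n" using j(1) k by (simp add: field_simps)
    then have "j * k \<le> nat \<lceil>a * real n\<rceil>" by linarith
    then have "hit 0 1 (nat \<lceil>a * real n\<rceil>) n no_exits [] \<le> hit 0 1 (j * k) n no_exits []"
      by (intro hit_antimono_level) auto
    also have "\<dots> = (1 / s ^ n) * (s ^ n * hit 0 1 (j * k) n no_exits [])" using s by simp
    also have "\<dots> \<le> (1 / s ^ n) * (exp (- \<mu> / a) / 2) ^ j"
      using s hit_discount_ge[of s n "j * k" no_exits "[]"] iter[of j n] by (intro mult_left_mono) auto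
    also have "\<dots> = exp (\<mu> * (real n / real k - real j / a)) * exp (- ln 2 * real j)"
    proof -
      have "exp (- \<mu> / a) / 2 = exp (- \<mu> / a - ln 2)" by (simp add: exp_diff)
      then have "(exp (- \<mu> / a) / 2) ^ j = exp (real j * (- \<mu> / a - ln 2))"
        by (simp only: exp_of_nat_mult)
      moreover have "1 / s ^ n = exp (real n * (\<mu> / real k))"
        unfolding s_def exp_of_nat_mult[symmetric] by (simp add: exp_minus divide_inverse)
      ultimately show ?thesis by (simp add: exp_add[symmetric] algebra_simps)
    qed
    also have "\<dots> \<le> exp (\<mu> * (1 / a)) * exp (ln 2 - \<delta> * real n)"
    proof (intro mult_mono)
      have "(a * real n / real k) / a \<le> (real j + 1) / a"
        using j(2) a by (intro divide_right_mono) auto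
      then have "real n / real k - real j / a \<le> 1 / a"
        using a by (simp add: add_divide_distrib)
      then show "exp (\<mu> * (real n / real k - real j / a)) \<le> exp (\<mu> * (1 / a))"
        unfolding exp_le_cancel_iff using \<mu> by (rule mult_left_mono)
      have "ln 2 * (a * real n / real k) \<le> ln 2 * (real j + 1)"
        using j(2) by (intro mult_left_mono) auto
      then show "exp (- ln 2 * real j) \<le> exp (ln 2 - \<delta> * real n)"
        by (simp add: \<delta>_def algebra_simps)
    qed auto
    also have "\<dots> = C * exp (- \<delta> * real n)"
      by (simp add: C_def exp_diff exp_minus divide_inverse)
    finally show ?thesis .
  qed
  moreover have "C > 0" "\<delta> > 0" using a k by (auto simp: C_def \<delta>_def)
  ultimately show ?thesis using that by blast
qed

end

context lrrw
begin

text \<open>The walk would have to be at height at least \<open>k\<close> at time \<open>\<lfloor>t * k\<rfloor>\<close> with a comparable probability,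
  by \<open>hit_le_above_at\<close>, which at a speed \<open>1 / t\<close> above \<open>T\<close> contradicts the law of large numbers.\<close>
lemma passage_time_lower:
  assumes lim: "AE \<omega> in M. (\<lambda>n. real (height (X n \<omega>)) / real n) \<longlonglongrightarrow> T"
    and t: "0 < t" "T < 1 / t" and q: "0 < q" "\<And>m. q \<le> survival 1 m no_exits []"
  shows "(\<lambda>k. hit 0 1 k (nat \<lfloor>t * real k\<rfloor>) no_exits []) \<longlonglongrightarrow> 0"
proof -
  let ?m = "\<lambda>k. nat \<lfloor>t * real k\<rfloor>"
  let ?p = "\<lambda>n. prob {\<omega> \<in> space M. 1 / t * real n \<le> real (height (X n \<omega>))}"
  have "filterlim ?m at_top sequentially"
    using t(1) by real_asymp
  then have "(\<lambda>k. ?p (?m k)) \<longlonglongrightarrow> 0"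
    by (rule filterlim_compose[OF prob_fast_tendsto_0[OF lim t(2)]])
  then have "(\<lambda>k. ?p (?m k) / q) \<longlonglongrightarrow> 0 / q"
    using q by (intro tendsto_divide tendsto_const) auto
  then have upper: "(\<lambda>k. ?p (?m k) / q) \<longlonglongrightarrow> 0" by simp
  have "hit 0 1 k (?m k) no_exits [] \<le> ?p (?m k) / q" if "k \<ge> 1" for k
  proof -
    have "real (?m k) \<le> t * real k" using t by simp
    then have "1 / t * real (?m k) \<le> real k" using t by (simp add: field_simps)
    then have "above_at k (?m k) no_exits [] \<le> ?p (?m k)"
      unfolding prob_above_at[symmetric] by (intro finite_measure_mono) auto
    moreover have "q * hit 0 1 k (?m k) no_exits [] \<le> above_at k (?m k) no_exits []"
      using that q by (intro hit_le_above_at) auto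
    ultimately show ?thesis using q by (simp add: field_simps)
  qed
  then have "eventually (\<lambda>k. hit 0 1 k (?m k) no_exits [] \<le> ?p (?m k) / q) sequentially"
    by (rule eventually_sequentiallyI)
  moreover have "eventually (\<lambda>k. 0 \<le> hit 0 1 k (?m k) no_exits []) sequentially"
    by (simp add: hit_nonneg)
  ultimately show ?thesis
    by (intro tendsto_sandwich[OF _ _ tendsto_const upper])
qed

text \<open>For the killed copy started by the first step, let \<open>Q n\<close> be the probability of success.  The
  probability of interest lies between \<open>q * Q n\<close> and \<open>(1 + n) * Q n\<close> and has the same rate, which
  \<open>passage_exp_bound\<close> shows to be positive.  The value functions depend on \<open>b\<close> only, so that the rate \<open>L\<close> obtained from one realisation of the
  walk is the rate of every other one.\<close>
lemma speed_up_rate: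
  assumes lim: "AE \<omega> in M. (\<lambda>n. real (height (X n \<omega>)) / real n) \<longlonglongrightarrow> T"
    and T: "0 < T" "T < a" and a: "a \<le> 1"
  obtains L where "L > 0"
    "(\<lambda>n. - ln (above_at (nat \<lceil>a * real n\<rceil>) n no_exits []) / real n) \<longlonglongrightarrow> L"
    "\<And>n. n \<ge> 1 \<Longrightarrow> above_at (nat \<lceil>a * real n\<rceil>) n no_exits [] > 0"
proof -
  obtain q where q: "q > 0" "\<And>m. q \<le> survival 1 m no_exits []"
    using survival_bounded_below[OF lim T(1)] by blast
  \<comment> \<open>Anything strictly between \<open>1 / a\<close> and \<open>1 / T\<close> would do.\<close>
  define t where "t = (1 / a + 1 / T) / 2"
  have inv: "1 / a < 1 / T" using T by (simp add: frac_less2)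
  have t: "0 < t" "1 / a < t" "t < 1 / T"
    using inv T unfolding t_def by (auto intro: add_pos_pos)
  have "T < 1 / t" using t T by (simp add: field_simps)
  obtain C \<delta> where C: "C > 0" "\<delta> > 0"
    "\<And>n. hit 0 1 (nat \<lceil>a * real n\<rceil>) n no_exits [] \<le> C * exp (- \<delta> * real n)"
    using passage_exp_bound[OF _ t(2) q passage_time_lower[OF lim t(1) \<open>T < 1 / t\<close> q]] T by auto
  define K where "K n = nat \<lceil>a * real n\<rceil>" for n
  define Q where "Q n = hit 1 1 (K n - 1) (n - 1) no_exits []" for n
  define p where "p n = above_at (K n) n no_exits []" for n
  obtain L where L: "(\<lambda>n. - ln (Q n) / real n) \<longlonglongrightarrow> L"
    using killed_passage_rate[of a] T a unfolding Q_def K_def by auto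
  have K1: "1 \<le> K n" if "n \<ge> 1" for n
    using that T by (simp add: K_def Suc_le_eq)
  have Qpos: "0 < Q n" for n
  proof -
    have "a * real n \<le> 1 * real n" using a by (intro mult_right_mono) auto
    then have "K n \<le> n" by (simp add: K_def ceiling_le_iff nat_le_iff)
    then show ?thesis unfolding Q_def by (intro hit_pos diff_le_mono)
  qed
  have av: "hit_before_root (K n) n no_exits [] = Q n" if "n \<ge> 1" for n
    using hit_before_root_Suc[of "K n - 1" "n - 1"] K1[OF that] that by (simp add: Q_def)
  have lower: "q * Q n \<le> p n" if "n \<ge> 1" for n
  proof -
    have "q * Q n \<le> q * hit 0 1 (K n) n no_exits []"
      using av[OF that] hit_before_root_le_hit[of "K n" n no_exits "[]"] q by simp
    also have "\<dots> \<le> p n" unfolding p_def using K1[OF that] q by (intro hit_le_above_at) auto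
    finally show ?thesis .
  qed
  have upper: "p n \<le> (1 + real n) * Q n" if "n \<ge> 1" for n
  proof -
    have "p n \<le> hit 0 1 (K n) n no_exits []" unfolding p_def by (rule above_at_le_hit)
    also have "\<dots> \<le> (1 + real n) * Q n"
      using hit_le_hit_before_root[OF K1[OF that], of n no_exits "[]"] av[OF that] by (simp add: algebra_simps)
    finally show ?thesis .
  qed
  have ppos: "0 < p n" if "n \<ge> 1" for n
    using lower[OF that] mult_pos_pos[OF q(1) Qpos[of n]] by linarith
  have "(\<lambda>n. - ln (p n) / real n) \<longlonglongrightarrow> L"
  proof (rule tendsto_sandwich)
    show "eventually (\<lambda>n. - ln (Q n) / real n - ln (1 + real n) / real n \<le> - ln (p n) / real n) sequentially"
    proof (rule eventually_sequentiallyI[of 1])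
      fix n :: nat assume n: "1 \<le> n"
      have "ln (p n) \<le> ln ((1 + real n) * Q n)" using upper[OF n] ppos[OF n] by (intro ln_mono) auto
      also have "\<dots> = ln (1 + real n) + ln (Q n)" using Qpos[of n] by (intro ln_mult_pos) auto
      finally have "(- ln (Q n) - ln (1 + real n)) / real n \<le> - ln (p n) / real n"
        by (intro divide_right_mono) auto
      then show "- ln (Q n) / real n - ln (1 + real n) / real n \<le> - ln (p n) / real n"
        by (simp only: diff_divide_distrib)
    qed
    show "eventually (\<lambda>n. - ln (p n) / real n \<le> - ln (Q n) / real n - ln q / real n) sequentially"
    proof (rule eventually_sequentiallyI[of 1])
      fix n :: nat assume n: "1 \<le> n"
      have "ln (q * Q n) \<le> ln (p n)" using lower[OF n] q Qpos[of n] by (intro ln_mono) auto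
      moreover have "ln (q * Q n) = ln q + ln (Q n)" using q Qpos[of n] by (intro ln_mult_pos) auto
      ultimately have "- ln (p n) / real n \<le> (- ln (Q n) - ln q) / real n"
        by (intro divide_right_mono) auto
      then show "- ln (p n) / real n \<le> - ln (Q n) / real n - ln q / real n"
        by (simp only: diff_divide_distrib)
    qed
    have "(\<lambda>n. ln (1 + real n) / real n) \<longlonglongrightarrow> 0" by real_asymp
    from tendsto_diff[OF L this] show "(\<lambda>n. - ln (Q n) / real n - ln (1 + real n) / real n) \<longlonglongrightarrow> L" by simp
    from tendsto_diff[OF L lim_const_over_n[of "ln q"]]
    show "(\<lambda>n. - ln (Q n) / real n - ln q / real n) \<longlonglongrightarrow> L" by simp
  qed
  moreover have "L > 0"
  proof -
    have "\<delta> - 0 \<le> L"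
    proof (rule tendsto_le[OF _ calculation])
      show "(\<lambda>n. \<delta> - ln C / real n) \<longlonglongrightarrow> \<delta> - 0" by (intro tendsto_diff tendsto_const lim_const_over_n)
      show "eventually (\<lambda>n. \<delta> - ln C / real n \<le> - ln (p n) / real n) sequentially"
      proof (rule eventually_sequentiallyI[of 1])
        fix n :: nat assume n: "1 \<le> n"
        have "p n \<le> C * exp (- \<delta> * real n)"
          using above_at_le_hit[of "K n" n no_exits "[]"] C(3)[of n] unfolding p_def K_def by linarith
        then have "ln (p n) \<le> ln (C * exp (- \<delta> * real n))"
          using ppos[OF n] by (intro ln_mono) auto
        also have "\<dots> = ln C - \<delta> * real n" using C by (simp add: ln_mult)
        finally have "(\<delta> * real n - ln C) / real n \<le> - ln (p n) / real n"
          by (intro divide_right_mono) auto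
        then show "\<delta> - ln C / real n \<le> - ln (p n) / real n"
          using n by (simp add: diff_divide_distrib)
      qed
    qed simp
    then show ?thesis using C(2) by simp
  qed
  ultimately show ?thesis using ppos that[of L] unfolding p_def K_def by blast
qed

end

theorem theorem1:
  fixes b :: nat and T \<epsilon> :: real
  assumes "b \<ge> 70"
    and "0 < T" and "T < real b / (real b + 2)"
    and "\<epsilon> > 0"
  shows "\<exists>\<alpha>::ereal. 0 < \<alpha> \<and> (T + \<epsilon> \<le> 1 \<longrightarrow> \<alpha> < \<infinity>) \<and>
    (\<forall>(M :: 'a measure) X.
       reinforced_walk b 2 M X \<longrightarrow>
       (AE \<omega> in M. (\<lambda>n. real (height (X n \<omega>)) / real n) \<longlonglongrightarrow> T) \<longrightarrow>
       (\<lambda>n. ereal (- 1 / real n) *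
             log_prob \<P>(\<omega> in M. real (height (X n \<omega>)) \<ge> (T + \<epsilon>) * real n))
         \<longlonglongrightarrow> \<alpha>)"
proof -
  interpret reinforced_tree b using assms by unfold_locales simp
  define a where "a = T + \<epsilon>"
  have a: "0 < a" "T < a" using assms by (auto simp: a_def)
  let ?p = "\<lambda>n. above_at (nat \<lceil>a * real n\<rceil>) n no_exits []"
  have prob: "\<P>(\<omega> in M. real (height (X n \<omega>)) \<ge> (T + \<epsilon>) * real n) = ?p n"
    if "reinforced_walk b 2 M X" for M :: "'a measure" and X n
  proof -
    interpret lrrw b M X using that by unfold_locales
    have "(T + \<epsilon>) * real n \<le> real (height (X n \<omega>)) \<longleftrightarrow> nat \<lceil>a * real n\<rceil> \<le> height (X n \<omega>)" for \<omega>
      by (simp add: a_def nat_le_iff ceiling_le_iff)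
    then show ?thesis by (simp only: prob_above_at)
  qed
  show ?thesis
  proof (cases "a \<le> 1")
    case False
    \<comment> \<open>The walk climbs at most one level per step, so that all probabilities but the first are 0.\<close>
    have "eventually (\<lambda>n. ereal (- 1 / real n) * log_prob (?p n) = \<infinity>) sequentially"
    proof (rule eventually_sequentiallyI[of 1])
      fix n :: nat assume n: "1 \<le> n"
      then have "real n < a * real n" using False by simp
      then have "n < nat \<lceil>a * real n\<rceil>" by linarith
      then have "?p n = 0" by (intro above_at_unreachable) simp
      then show "ereal (- 1 / real n) * log_prob (?p n) = \<infinity>"
        using n by (simp add: log_prob_def)
    qed
    then have "(\<lambda>n. ereal (- 1 / real n) * log_prob (?p n)) \<longlonglongrightarrow> \<infinity>"
      by (rule tendsto_eventually)
    then show ?thesis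
      using False by (intro exI[of _ \<infinity>]) (auto simp: prob a_def)
  next
    case True
    show ?thesis
    proof (cases "\<exists>(M :: 'a measure) X. reinforced_walk b 2 M X \<and>
        (AE \<omega> in M. (\<lambda>n. real (height (X n \<omega>)) / real n) \<longlonglongrightarrow> T)")
      case False
      \<comment> \<open>Without any realisation of the walk the value of the rate is immaterial.\<close>
      then show ?thesis by (intro exI[of _ 1]) auto
    next
      case ex: True
      then obtain M :: "'a measure" and X where MX: "reinforced_walk b 2 M X"
        "AE \<omega> in M. (\<lambda>n. real (height (X n \<omega>)) / real n) \<longlonglongrightarrow> T" by blast
      interpret lrrw b M X using MX by unfold_locales
      obtain L where L: "L > 0" "(\<lambda>n. - ln (?p n) / real n) \<longlonglongrightarrow> L" "\<And>n. n \<ge> 1 \<Longrightarrow> ?p n > 0"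
        using speed_up_rate[OF MX(2) assms(2) a(2) True] by blast
      have "(\<lambda>n. ereal (- 1 / real n) * log_prob (?p n)) \<longlonglongrightarrow> ereal L"
      proof (rule Lim_transform_eventually)
        show "(\<lambda>n. ereal (- ln (?p n) / real n)) \<longlonglongrightarrow> ereal L" using L(2) by simp
        show "eventually (\<lambda>n. ereal (- ln (?p n) / real n) = ereal (- 1 / real n) * log_prob (?p n)) sequentially"
          using L(3) by (intro eventually_sequentiallyI[of 1]) (auto simp: log_prob_def less_le)
      qed
      then show ?thesis using L(1) by (intro exI[of _ "ereal L"]) (auto simp: prob)
    qed
  qed
qed

end
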